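(* Let $n\ge 3$. Every bipartite NIC-planar graph with $n$ vertices has at most $2.5n-5$ edges.
   Context: Graphs are simple. A topological drawing places vertices at distinct points and edges as Jordan arcs between their endpoints, such that no edge passes through a vertex other than its endpoints, no two adjacent edges cross, no edge crosses itself, no two edges meet tangentially, and any two edges cross at most once. A graph is NIC-planar if it admits such a drawing in which every edge is crossed at most once and no two crossing pairs of edges share two endpoints. *)

theory Defs
  imports "HOL-Analysis.Analysis"
begin

definition simple_graph :: "'a set \<Rightarrow> 'a set set \<Rightarrow> bool" where
  "simple_graph V E \<longleftrightarrow> finite V \<and> (\<forall>e\<in>E. e \<subseteq> V \<and> card e = 2)"

definition bipartite_graph :: "'a set \<Rightarrow> 'a set set \<Rightarrow> bool" where
  "bipartite_graph V E \<longleftrightarrow>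
     (\<exists>A B. A \<union> B = V \<and> A \<inter> B = {} \<and> (\<forall>e\<in>E. \<exists>a\<in>A. \<exists>b\<in>B. e = {a, b}))"

text \<open>
  The plane is \<^typ>\<open>complex\<close>. Two arcs (given by their images \<open>A\<close> and \<open>B\<close>) cross at \<open>p\<close> if some
  homeomorphism from a neighbourhood of \<open>p\<close> onto the open unit disc maps \<open>p\<close> to the centre, \<open>A\<close> to
  the horizontal diameter and \<open>B\<close> to the vertical one. A common point at which the arcs merely
  touch, or which is an end of one of them, or which lies on a common subarc, is not a crossing.
\<close>

definition crosses_at :: "complex set \<Rightarrow> complex set \<Rightarrow> complex \<Rightarrow> bool" where
  "crosses_at A B p \<longleftrightarrow>
     (\<exists>U h k. open U \<and> p \<in> U \<and> homeomorphism U (ball 0 1) h k \<and> h p = 0 \<and>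
        h ` (U \<inter> A) = {z \<in> ball 0 1. Im z = 0} \<and>
        h ` (U \<inter> B) = {z \<in> ball 0 1. Re z = 0})"

definition edges_cross_at ::
    "('a set \<Rightarrow> real \<Rightarrow> complex) \<Rightarrow> 'a set \<Rightarrow> 'a set \<Rightarrow> complex \<Rightarrow> bool" where
  "edges_cross_at \<gamma> e f p \<longleftrightarrow> e \<noteq> f \<and> crosses_at (path_image (\<gamma> e)) (path_image (\<gamma> f)) p"

text \<open>
  A drawing consists of a placement \<open>\<pi>\<close> of the vertices and a parametrised arc \<open>\<gamma> e\<close> for each edge
  \<open>e\<close>. Being an \<^const>\<open>arc\<close>, that is, an injective path, rules out self-crossings. The fifth
  condition excludes tangential meetings: any point common to two edges is either a common
  endpoint or a crossing.
\<close>

definition topological_drawing ::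
    "'a set \<Rightarrow> 'a set set \<Rightarrow> ('a \<Rightarrow> complex) \<Rightarrow> ('a set \<Rightarrow> real \<Rightarrow> complex) \<Rightarrow> bool" where
  "topological_drawing V E \<pi> \<gamma> \<longleftrightarrow>
     inj_on \<pi> V \<and>
     (\<forall>e\<in>E. arc (\<gamma> e) \<and> {pathstart (\<gamma> e), pathfinish (\<gamma> e)} = \<pi> ` e) \<and>
     (\<forall>e\<in>E. \<forall>v\<in>V. \<pi> v \<in> path_image (\<gamma> e) \<longrightarrow> v \<in> e) \<and>
     (\<forall>e\<in>E. \<forall>f\<in>E. e \<inter> f \<noteq> {} \<longrightarrow> (\<forall>p. \<not> edges_cross_at \<gamma> e f p)) \<and>
     (\<forall>e\<in>E. \<forall>f\<in>E. e \<noteq> f \<longrightarrow>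
        (\<forall>p \<in> path_image (\<gamma> e) \<inter> path_image (\<gamma> f). p \<in> \<pi> ` (e \<inter> f) \<or> edges_cross_at \<gamma> e f p)) \<and>
     (\<forall>e\<in>E. \<forall>f\<in>E. \<forall>p q. edges_cross_at \<gamma> e f p \<longrightarrow> edges_cross_at \<gamma> e f q \<longrightarrow> p = q)"

text \<open>
  A crossing of \<open>e\<close> is a pair of a crossing edge and a crossing point, so two edges crossing \<open>e\<close>
  at the same point count as two crossings. Sharing two endpoints means sharing at least two of
  the four.
\<close>

definition nic_drawing ::
    "'a set \<Rightarrow> 'a set set \<Rightarrow> ('a \<Rightarrow> complex) \<Rightarrow> ('a set \<Rightarrow> real \<Rightarrow> complex) \<Rightarrow> bool" where
  "nic_drawing V E \<pi> \<gamma> \<longleftrightarrow>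
     topological_drawing V E \<pi> \<gamma> \<and>
     (\<forall>e\<in>E. \<forall>f\<in>E. \<forall>g\<in>E. \<forall>p q.
        edges_cross_at \<gamma> e f p \<longrightarrow> edges_cross_at \<gamma> e g q \<longrightarrow> f = g \<and> p = q) \<and>
     (\<forall>e\<in>E. \<forall>f\<in>E. \<forall>e'\<in>E. \<forall>f'\<in>E.
        (\<exists>p. edges_cross_at \<gamma> e f p) \<longrightarrow> (\<exists>q. edges_cross_at \<gamma> e' f' q) \<longrightarrow>
        {e, f} \<noteq> {e', f'} \<longrightarrow> card ((e \<union> f) \<inter> (e' \<union> f')) < 2)"

definition nic_planar :: "'a set \<Rightarrow> 'a set set \<Rightarrow> bool" where
  "nic_planar V E \<longleftrightarrow> (\<exists>\<pi> \<gamma>. nic_drawing V E \<pi> \<gamma>)"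

end

theory Submission
  imports Defs
begin

text \<open>
  Turn the \<open>k\<close> crossings into vertices. This gives a plane graph with \<open>n + k\<close> vertices, \<open>m + 2 k\<close> edges
  and, by Euler's formula, at least \<open>m + k - n + 2\<close> faces. At a crossing of \<open>a b\<close> and \<open>c d\<close> two of the four
  sectors are monochromatic, i.e. lie between half-edges leading to vertices of the same colour, and
  the other two are bichromatic. A face of degree \<open>d\<close> with \<open>s\<close> monochromatic and \<open>t\<close> bichromatic sectors satisfies
  \<open>20 + 4 s \<le> 6 d + 2 t\<close>: distinct monochromatic sectors use disjoint pairs of half-edges, so \<open>2 s \<le> d\<close>,
  which settles \<open>d \<ge> 5\<close>; for \<open>d = 4\<close> and \<open>s = 2\<close> two crossings would share two vertices; and
  a triangle must consist of one crossing and an uncrossed edge, so that \<open>s = 0\<close> and \<open>t \<ge> 1\<close>. Summing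
  over all faces, where \<open>s\<close> and \<open>t\<close> both add up to \<open>2 k\<close>, and inserting Euler's formula yields \<open>2 m \<le> 5 n - 10\<close>.
  If there is only one face, then \<open>m < n\<close> by Euler's formula.

  All facts about faces come from adding one arc at a time and Janiszewski's theorem: a new arc splits
  exactly one complementary component, into two pieces if its ends were already connected and into
  one otherwise.
\<close>

subsection \<open>Adding an arc to a compact set\<close>

text \<open>Write the face inequality as \<open>a + b s \<le> 6 d + c t\<close>. Summed over the
  faces and combined with Euler's formula it yields the ratio \<open>5/2\<close> for
  \<open>a = 20\<close>, and \<open>k\<close> cancels for \<open>b - c = 2\<close>. A triangle with
  one bichromatic sector forces \<open>c \<ge> 2\<close>, and a face of degree 4 with one
  monochromatic and no bichromatic sector forces \<open>b \<le> 4\<close>, so \<open>b = 4\<close>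
  and \<open>c = 2\<close> are the only choice.

  The drawing need not be connected, and the boundary of a face is never traversed as a closed walk.
  The degree counts sides of arcs, a bridge counting twice. A boundary walk is replaced by two
  facts: an arc borders one or two faces; and if there are at least two faces, the arcs bordering a
  face contain a nonempty set in which every end of an arc is also an end of another arc of the set.
  The second fact fails for forests, which is why a single face is treated separately. Bipartiteness
  acts through triangles and through the alternation of sectors; the condition on shared endpoints
  only excludes two monochromatic sectors in a face of degree 4.\<close>

lemma interior_arc_empty:
  fixes g :: "real \<Rightarrow> complex"
  assumes "arc g"
  shows "interior (path_image g) = {}"
proof (rule ccontr)
  assume ne: "interior (path_image g) \<noteq> {}"
  obtain h where h: "homeomorphism {0..1} (path_image g) g h"
    using homeomorphism_arc[OF assms] by blast
  have "continuous_on (interior (path_image g)) h"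
    using h interior_subset homeomorphism_cont2 continuous_on_subset by blast
  moreover have "inj_on h (interior (path_image g))"
    using h interior_subset[of "path_image g"] by (metis inj_on_inverseI inj_on_subset homeomorphism_def)
  ultimately have "DIM(complex) \<le> DIM(real)"
    using ne by (intro invariance_of_dimension) auto
  then show False by simp
qed

lemma arc_minus_ends:
  assumes "arc g"
  shows "connected (path_image g - {pathstart g, pathfinish g})"
    and "path_image g - {pathstart g, pathfinish g} \<noteq> {}"
    and "path_image g \<subseteq> closure (path_image g - {pathstart g, pathfinish g})"
proof -
  have sg: "simple_path g" using assms arc_imp_simple_path by blast
  show "connected (path_image g - {pathstart g, pathfinish g})"
    using connected_simple_path_endless[OF sg] .
  show "path_image g - {pathstart g, pathfinish g} \<noteq> {}"
    using nonempty_simple_path_endless[OF sg] .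
  have c: "continuous_on (closure {0<..<1}) g"
    using assms by (simp add: arc_def path_def)
  have "g ` closure {0<..<1} \<subseteq> closure (g ` {0<..<1})"
    using image_closure_subset[OF c] closure_subset by (metis closed_closure)
  then show "path_image g \<subseteq> closure (path_image g - {pathstart g, pathfinish g})"
    unfolding simple_path_endless[OF sg] by (simp add: path_image_def)
qed

text \<open>All of \<open>A\<close> outside \<open>K\<close> lies in \<open>C\<close>, so the other
  components survive unchanged. Disjoint nonempty open connected sets with the right union can only
  be the components.\<close>

lemma components_add_closed:
  fixes K :: "complex set"
  assumes "C \<in> components (- K)" "A - K \<subseteq> C"
    and F: "\<Union>F = C - A" "pairwise disjnt F"
      "\<And>f. f \<in> F \<Longrightarrow> open f \<and> connected f \<and> f \<noteq> {}"
    and "closed K"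
  shows "components (- (K \<union> A)) = components (- K) - {C} \<union> F"
proof (rule components_open_unique)
  have opK: "open (- K)" using assms by auto
  have sub: "f \<subseteq> C" if "f \<in> F" for f using F that by auto
  have dis: "disjnt D D'" if "D \<in> components (- K)" "D' \<in> components (- K)" "D \<noteq> D'" for D D'
    using components_nonoverlap that unfolding disjnt_def by blast
  show "pairwise disjnt (components (- K) - {C} \<union> F)"
    unfolding pairwise_def
  proof (intro ballI impI)
    fix x y assume xy: "x \<in> components (- K) - {C} \<union> F" "y \<in> components (- K) - {C} \<union> F" "x \<noteq> y"
    consider "x \<in> F" "y \<in> F" | "x \<in> F" "y \<in> components (-K) - {C}"
      | "x \<in> components (-K) - {C}" "y \<in> F" | "x \<in> components (-K) - {C}" "y \<in> components (-K) - {C}"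
      using xy by blast
    then show "disjnt x y"
    proof cases
      case 1 then show ?thesis using F(2) xy unfolding pairwise_def by blast
    next
      case 2 then show ?thesis using sub dis[of C y] assms(1) by (auto simp: disjnt_def)
    next
      case 3 then show ?thesis using sub dis[of x C] assms(1) by (auto simp: disjnt_def)
    next
      case 4 then show ?thesis using dis xy by blast
    qed
  qed
  have "\<Union>(components (- K)) = - K" by simp
  moreover have "D \<inter> A = {}" if "D \<in> components (- K) - {C}" for D
  proof -
    have "D \<subseteq> - K" "D \<inter> C = {}" using that dis[of D C] assms(1) in_components_subset
      by (auto simp: disjnt_def)
    then show ?thesis using assms(2) by auto
  qed
  moreover have "C \<subseteq> - K" using assms(1) in_components_subset by blast
  ultimately show "\<Union>(components (- K) - {C} \<union> F) = - (K \<union> A)"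
  proof -
    assume 1: "\<Union>(components (- K)) = - K"
      and 2: "\<And>D. D \<in> components (- K) - {C} \<Longrightarrow> D \<inter> A = {}" and 3: "C \<subseteq> - K"
    have "components (- K) = insert C (components (- K) - {C})" using assms(1) by blast
    then have "- K = C \<union> \<Union>(components (- K) - {C})" using 1 by (metis Union_insert)
    moreover have "\<Union>(components (- K) - {C}) \<inter> A = {}" using 2 by blast
    moreover have "C - A \<union> X = - (K \<union> A)" if "- K = C \<union> X" "X \<inter> A = {}" for X
      using that by auto
    ultimately have "C - A \<union> \<Union>(components (- K) - {C}) = - (K \<union> A)" by metis
    then show ?thesis unfolding Union_Un_distrib F(1) by (metis Un_commute)
  qed
  show "open X \<and> connected X \<and> X \<noteq> {}" if "X \<in> components (- K) - {C} \<union> F" for X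
    using that F(3) open_components[OF opK] in_components_connected in_components_nonempty by blast
qed

text \<open>Meeting \<open>K\<close> in the ends only makes \<open>A - K\<close> connected, so it
  falls into a single component of the complement, and only that component can change.\<close>

locale new_arc =
  fixes K :: "complex set" and g :: "real \<Rightarrow> complex"
  assumes compact_K: "compact K" and arc_g: "arc g"
    and meet: "path_image g \<inter> K = {pathstart g, pathfinish g}"
begin

abbreviation "A \<equiv> path_image g"

lemma A_minus_K: "A - K = A - {pathstart g, pathfinish g}"
  using meet by auto

lemma A_closure: "A \<subseteq> closure (A - K)"
  unfolding A_minus_K using arc_minus_ends(3)[OF arc_g] .

lemma component_exists:
  obtains C where "C \<in> components (- K)" "A - K \<subseteq> C" "open C" "C \<inter> K = {}" "A - K \<noteq> {}"
proof -
  have "A - K \<noteq> {}" using arc_minus_ends(2)[OF arc_g] A_minus_K by simp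
  moreover obtain C where "C \<in> components (- K)" "A - K \<subseteq> C"
  proof -
    have "A - K \<subseteq> - K" "- K \<noteq> {}" using calculation by blast+
    then show thesis
      using exists_component_superset[of "A - K" "- K"] arc_minus_ends(1)[OF arc_g] A_minus_K that by auto
  qed
  moreover have "open C" using calculation compact_K
    by (meson compact_imp_closed open_Compl open_components)
  moreover have "C \<inter> K = {}" using calculation(2) in_components_subset by blast
  ultimately show thesis using that by blast
qed

text \<open>
  The new arc together with an arc \<open>k\<close> in \<open>K\<close> forms a closed curve \<open>J\<close>, and \<open>K \<inter> J = k\<close> is
  connected, so by Janiszewski's theorem two points on the same side of \<open>J\<close> that \<open>K\<close> does not
  separate are not separated by \<open>K \<union> J\<close> either.
\<close>

lemma split_connected:
  assumes "path_component K (pathstart g) (pathfinish g)"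
  shows "\<exists>C F. C \<in> components (- K) \<and> A - K \<subseteq> C \<and>
     components (- (K \<union> A)) = components (- K) - {C} \<union> F \<and>
     F \<inter> components (- K) = {} \<and> card F = 2 \<and> (\<forall>f\<in>F. A \<subseteq> closure f)"
proof -
  obtain C where C: "C \<in> components (- K)" "A - K \<subseteq> C" "open C" "C \<inter> K = {}" "A - K \<noteq> {}"
    using component_exists by blast
  have ends: "pathfinish g \<noteq> pathstart g" using arc_distinct_ends[OF arc_g] .
  obtain p where p: "path p" "path_image p \<subseteq> K" "pathstart p = pathfinish g" "pathfinish p = pathstart g"
    using path_component_sym[OF assms] unfolding path_component_def by (elim exE conjE) (rule that)
  obtain k where k: "arc k" "path_image k \<subseteq> K" "pathstart k = pathfinish g" "pathfinish k = pathstart g"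
    by (rule path_contains_arc[OF p(1,3,4) ends]) (use p(2) in auto)
  define J where "J = path_image (g +++ k)"
  have J: "J = A \<union> path_image k"
    unfolding J_def using k by (simp add: path_image_join)
  have "simple_path (g +++ k)"
    using k meet by (intro simple_path_join_loop) (auto simp: arc_g)
  moreover have "pathfinish (g +++ k) = pathstart (g +++ k)" using k by simp
  ultimately have JJ: "open (inside J)" "connected (inside J)" "open (outside J)" "connected (outside J)"
     "inside J \<inter> outside J = {}" "inside J \<union> outside J = - J"
     "frontier (inside J) = J" "frontier (outside J) = J"
    using Jordan_inside_outside[of "g +++ k"] unfolding J_def by auto
  have cJ: "compact J" unfolding J using k(1) arc_g by (simp add: compact_Un compact_arc_image)
  have "K \<inter> J = (A \<inter> K) \<union> path_image k" using k(2) J by blast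
  then have JK: "K \<inter> J = path_image k"
    unfolding meet using k pathstart_in_path_image[of k] pathfinish_in_path_image[of k] by auto
  have KJ: "K \<union> J = K \<union> A" using k J by auto
  have conn: "connected (C \<inter> I)" if I: "I = inside J \<or> I = outside J" for I
    unfolding connected_iff_connected_component
  proof (intro ballI)
    fix a b assume ab: "a \<in> C \<inter> I" "b \<in> C \<inter> I"
    have IJ: "I \<inter> J = {}" "connected I"
      using JJ(2,4) I inside_no_overlap[of J] outside_no_overlap[of J] by metis+
    have "connected_component (- K) a b"
      unfolding connected_component_def
      using ab in_components_connected[OF C(1)] in_components_subset[OF C(1)] by blast
    moreover have "connected_component (- J) a b"
      unfolding connected_component_def using IJ ab by blast
    moreover have "connected (K \<inter> J)" using JK k by (simp add: connected_arc_image)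
    ultimately have "connected_component (- (K \<union> J)) a b"
      using Janiszewski[of K J a b] compact_K cJ compact_imp_closed by blast
    then obtain T where T: "connected T" "T \<subseteq> - (K \<union> J)" "a \<in> T" "b \<in> T"
      unfolding connected_component_def by blast
    have "T \<subseteq> C" using components_maximal[OF C(1) T(1)] T ab by auto
    moreover have "T \<subseteq> I"
    proof -
      have TJ: "T \<subseteq> inside J \<union> outside J" using T(2) unfolding JJ(6) by blast
      then have "inside J \<inter> T = {} \<or> outside J \<inter> T = {}"
        using connectedD[OF T(1) JJ(1,3)] TJ JJ(5) by blast
      then show ?thesis using I T(3) ab TJ by blast
    qed
    ultimately show "connected_component (C \<inter> I) a b"
      unfolding connected_component_def using T by blast
  qed
  \<comment> \<open>Each side of \<open>J\<close> has all of \<open>J\<close> as its frontier, so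
    inside the open set \<open>C\<close> both sides come arbitrarily close to every point of
    \<open>A - K\<close>. Hence both pieces are nonempty and have \<open>A\<close> in their
    closure.\<close>
  have cl: "A \<subseteq> closure (C \<inter> I)" if I: "I = inside J \<or> I = outside J" for I
  proof -
    have "A - K \<subseteq> closure I"
      using I JJ(7,8) J unfolding frontier_def by auto
    then have "A - K \<subseteq> C \<inter> closure I" using C by auto
    also have "\<dots> \<subseteq> closure (C \<inter> I)" using C(3) by (rule open_Int_closure_subset)
    finally have "closure (A - K) \<subseteq> closure (C \<inter> I)" by (simp add: closure_minimal)
    then show ?thesis using A_closure by auto
  qed
  have ne: "C \<inter> I \<noteq> {}" if I: "I = inside J \<or> I = outside J" for I
    using cl[OF I] C(5) by auto
  let ?F = "{C \<inter> inside J, C \<inter> outside J}"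
  have "components (- (K \<union> A)) = components (- K) - {C} \<union> ?F"
  proof (rule components_add_closed[OF C(1,2)])
    have "C \<inter> path_image k = {}" using C k by auto
    then have "C - A = C \<inter> (inside J \<union> outside J)" unfolding JJ(6) using J by blast
    then show "\<Union>?F = C - A" by (simp only: Int_Un_distrib Union_insert Union_empty Un_empty_right)
    show "pairwise disjnt ?F" using JJ(5) unfolding pairwise_def disjnt_def by blast
    show "closed K" using compact_K compact_imp_closed by blast
    show "open f \<and> connected f \<and> f \<noteq> {}" if "f \<in> ?F" for f
      using that conn ne open_Int[OF C(3) JJ(1)] open_Int[OF C(3) JJ(3)] by blast
  qed
  moreover have "card ?F = 2"
  proof -
    have "C \<inter> inside J \<noteq> C \<inter> outside J" using ne[of "inside J"] JJ(5) by blast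
    then show ?thesis by simp
  qed
  moreover have "?F \<inter> components (- K) = {}"
  proof -
    have "f \<notin> components (- K)" if "f \<in> ?F" for f
    proof
      assume "f \<in> components (- K)"
      moreover have "f \<inter> C \<noteq> {}" using that ne by auto
      ultimately have "f = C" using C(1) components_nonoverlap by metis
      then show False using that C(2,5) J inside_no_overlap[of J] outside_no_overlap[of J] by blast
    qed
    then show ?thesis by blast
  qed
  ultimately show ?thesis using C(1,2) cl by (intro exI[of _ C] exI[of _ ?F]) simp
qed

text \<open>The arc meets \<open>K1\<close> in one point, and \<open>K1\<close> together with the
  arc meets \<open>K2\<close> in one point. An arc does not separate the plane, so two uses of
  Janiszewski's theorem show that \<open>C - A\<close> stays connected.\<close>

lemma split_disconnected:
  assumes K: "K = K1 \<union> K2" "closed K1" "closed K2" "K1 \<inter> K2 = {}" "pathstart g \<in> K1" "pathfinish g \<in> K2"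
  shows "\<exists>C F. C \<in> components (- K) \<and> A - K \<subseteq> C \<and>
     components (- (K \<union> A)) = components (- K) - {C} \<union> F \<and>
     F \<inter> components (- K) = {} \<and> card F = 1 \<and> (\<forall>f\<in>F. A \<subseteq> closure f)"
proof -
  obtain C where C: "C \<in> components (- K)" "A - K \<subseteq> C" "open C" "C \<inter> K = {}" "A - K \<noteq> {}"
    using component_exists by blast
  have cA: "compact A" using arc_g by (simp add: compact_arc_image)
  have c12: "compact K1" "compact K2"
    using compact_Int_closed[OF compact_K K(2)] compact_Int_closed[OF compact_K K(3)] K(1)
    by (simp_all add: Int_absorb1)
  have conn: "connected (C - A)"
    unfolding connected_iff_connected_component
  proof (intro ballI)
    fix a b assume ab: "a \<in> C - A" "b \<in> C - A"
    have 1: "connected_component (- K) a b"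
      unfolding connected_component_def
      using ab in_components_connected[OF C(1)] in_components_subset[OF C(1)] by blast
    have 2: "connected_component (- A) a b"
      using ab connected_arc_complement[OF arc_g] unfolding connected_component_def by auto
    have "K1 \<inter> A = {pathstart g}" using K meet by auto
    then have 3: "connected_component (- (K1 \<union> A)) a b"
      using Janiszewski[OF c12(1) compact_imp_closed[OF cA], of a b] 2 1 connected_component_mono[of "- K" "- K1"] K by auto
    have "(K1 \<union> A) \<inter> K2 = {pathfinish g}" using K meet by auto
    then have "connected_component (- ((K1 \<union> A) \<union> K2)) a b"
      using Janiszewski[OF compact_Un[OF c12(1) cA] K(3), of a b] 3 1 connected_component_mono[of "- K" "- K2"] K by auto
    then have "connected_component (- (K \<union> A)) a b" using K(1) by (simp add: Un_ac)
    then obtain T where T: "connected T" "T \<subseteq> - (K \<union> A)" "a \<in> T" "b \<in> T"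
      unfolding connected_component_def by blast
    have "T \<subseteq> C" using components_maximal[OF C(1) T(1)] T ab by auto
    then show "connected_component (C - A) a b"
      unfolding connected_component_def using T by blast
  qed
  \<comment> \<open>An arc has empty interior, so \<open>C - A\<close> is dense in \<open>C\<close>:
    it is nonempty, and its closure contains \<open>A\<close>.\<close>
  have cl: "C \<subseteq> closure (C - A)"
  proof -
    have "closure (- A) = UNIV" using interior_arc_empty[OF arc_g] by (simp add: closure_interior)
    then have "C \<subseteq> C \<inter> closure (- A)" by auto
    also have "\<dots> \<subseteq> closure (C \<inter> - A)" using C(3) by (rule open_Int_closure_subset)
    finally show ?thesis by (simp add: Diff_eq)
  qed
  have ne: "C - A \<noteq> {}"
  proof
    assume "C - A = {}"
    then have "C \<subseteq> {}" using cl by (metis closure_empty)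
    then show False using C(2,5) by blast
  qed
  have "components (- (K \<union> A)) = components (- K) - {C} \<union> {C - A}"
  proof (rule components_add_closed[OF C(1,2)])
    show "open f \<and> connected f \<and> f \<noteq> {}" if "f \<in> {C - A}" for f
      using that conn ne C(3) cA compact_imp_closed by blast
    show "closed K" using compact_K compact_imp_closed by blast
  qed auto
  moreover have "C - A \<notin> components (- K)"
  proof
    assume "C - A \<in> components (- K)"
    moreover have "(C - A) \<inter> C \<noteq> {}" using ne by auto
    ultimately have "C - A = C" using C(1) components_nonoverlap by metis
    then show False using C(2,5) by auto
  qed
  moreover have "A \<subseteq> closure (C - A)"
    using A_closure closure_minimal[OF subset_trans[OF C(2) cl] closed_closure] by (rule subset_trans)
  ultimately show ?thesis using C(1,2) by (intro exI[of _ C] exI[of _ "{C - A}"]) simp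
qed

end

subsection \<open>Plane graphs and their faces\<close>

text \<open>A path connected member of \<open>Q\<close> that meets the path component of
  \<open>u\<close> lies inside it. Sorting the members accordingly gives two disjoint unions, closed
  because \<open>Q\<close> is finite; \<open>split_disconnected\<close> needs such a
  partition.\<close>

lemma closed_separation_of_path_components:
  fixes Q :: "'a::topological_space set set"
  assumes "finite Q" and Q: "\<And>P. P \<in> Q \<Longrightarrow> closed P \<and> path_connected P"
    and "u \<in> \<Union>Q" "v \<in> \<Union>Q" "\<not> path_component (\<Union>Q) u v"
  obtains K1 K2 where "\<Union>Q = K1 \<union> K2" "closed K1" "closed K2" "K1 \<inter> K2 = {}" "u \<in> K1" "v \<in> K2"
proof -
  let ?c = "path_component_set (\<Union>Q) u"
  define Q1 where "Q1 = {P \<in> Q. P \<inter> ?c \<noteq> {}}"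
  have sub: "P \<subseteq> ?c" if P: "P \<in> Q1" for P
  proof
    fix y assume "y \<in> P"
    obtain x where x: "x \<in> P" "path_component (\<Union>Q) u x" using P unfolding Q1_def by auto
    have "path_component P x y"
      using Q P \<open>x \<in> P\<close> \<open>y \<in> P\<close> unfolding Q1_def path_connected_component by auto
    then have "path_component (\<Union>Q) x y"
      using P path_component_of_subset[of P "\<Union>Q"] unfolding Q1_def by auto
    then show "y \<in> ?c" using x path_component_trans by (metis mem_Collect_eq)
  qed
  have "path_component (\<Union>Q) u u" using assms(3) path_component_refl by metis
  then have "u \<in> \<Union>Q1" using assms(3) unfolding Q1_def by auto
  moreover have "v \<in> \<Union>(Q - Q1)" using assms(4,5) sub by blast
  moreover have "\<Union>Q1 \<inter> \<Union>(Q - Q1) = {}" using sub unfolding Q1_def by blast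
  moreover have "\<Union>Q = \<Union>Q1 \<union> \<Union>(Q - Q1)" unfolding Q1_def by blast
  moreover have "closed (\<Union>Q1)" "closed (\<Union>(Q - Q1))"
    using assms(1) Q unfolding Q1_def by (auto intro!: closed_Union)
  ultimately show thesis using that by blast
qed

text \<open>Edges are point sets, hence carry no orientation. Parallel edges, isolated vertices and
  disconnected graphs are allowed.\<close>

definition plane_graph :: "complex set \<Rightarrow> complex set set \<Rightarrow> bool" where
  "plane_graph W S \<longleftrightarrow> finite W \<and> finite S \<and>
     (\<forall>A\<in>S. \<exists>g. arc g \<and> path_image g = A \<and> A \<inter> W = {pathstart g, pathfinish g}) \<and>
     (\<forall>A\<in>S. \<forall>B\<in>S. A \<noteq> B \<longrightarrow> A \<inter> B \<subseteq> W)"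

definition faces :: "complex set \<Rightarrow> complex set set \<Rightarrow> complex set set" where
  "faces W S = components (- (W \<union> \<Union>S))"

text \<open>The ends are left out because they may touch faces that the edge does not border. A
  single point of the open edge suffices: by \<open>plane_graph_incident_faces\<close> the whole
  edge then lies in the closure of the face.\<close>

definition incident :: "complex set \<Rightarrow> complex set \<Rightarrow> complex set \<Rightarrow> bool" where
  "incident W A f \<longleftrightarrow> (A - W) \<inter> closure f \<noteq> {}"

lemma plane_graph_arc:
  assumes "plane_graph W S" "A \<in> S"
  obtains g where "arc g" "path_image g = A" "A \<inter> W = {pathstart g, pathfinish g}"
  using assms unfolding plane_graph_def by metis

lemma plane_graph_arc_Int:
  "plane_graph W S \<Longrightarrow> A \<in> S \<Longrightarrow> B \<in> S \<Longrightarrow> A \<noteq> B \<Longrightarrow> A \<inter> B \<subseteq> W"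
  unfolding plane_graph_def by metis

lemma plane_graph_finite: "plane_graph W S \<Longrightarrow> finite W" "plane_graph W S \<Longrightarrow> finite S"
  unfolding plane_graph_def by auto

lemma plane_graph_subset: "plane_graph W S \<Longrightarrow> T \<subseteq> S \<Longrightarrow> plane_graph W T"
  unfolding plane_graph_def by (meson finite_subset subsetD)

lemma plane_graph_compact:
  assumes "plane_graph W S"
  shows "compact (W \<union> \<Union>S)"
proof -
  have "compact A" if "A \<in> S" for A
    using that plane_graph_arc[OF assms] compact_arc_image by metis
  then show ?thesis using plane_graph_finite[OF assms]
    by (metis compact_Un compact_Union finite_imp_compact)
qed

lemma plane_graph_new_arc:
  assumes "plane_graph W (insert A S)" "A \<notin> S"
  obtains g where "arc g" "path_image g = A" "A \<inter> W = {pathstart g, pathfinish g}"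
    "new_arc (W \<union> \<Union>S) g" "A - W = A - (W \<union> \<Union>S)"
proof -
  obtain g where g: "arc g" "path_image g = A" "A \<inter> W = {pathstart g, pathfinish g}"
    using plane_graph_arc[OF assms(1) insertI1] by metis
  have "A \<inter> B \<subseteq> W" if "B \<in> S" for B
    using plane_graph_arc_Int[OF assms(1)] assms(2) that by (metis insertI1 insertI2)
  then have "A \<inter> (W \<union> \<Union>S) = A \<inter> W" "A - W = A - (W \<union> \<Union>S)" by blast+
  moreover have "compact (W \<union> \<Union>S)"
    using plane_graph_compact plane_graph_subset[OF assms(1)] by blast
  ultimately show thesis using that g unfolding new_arc_def by simp
qed

lemma plane_graph_separation:
  assumes "plane_graph W S" "u \<in> W" "v \<in> W" "\<not> path_component (W \<union> \<Union>S) u v"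
  obtains K1 K2 where "W \<union> \<Union>S = K1 \<union> K2" "closed K1" "closed K2" "K1 \<inter> K2 = {}" "u \<in> K1" "v \<in> K2"
proof -
  define Q where "Q = S \<union> (\<lambda>w. {w}) ` W"
  have UQ: "\<Union>Q = W \<union> \<Union>S" unfolding Q_def by auto
  have "closed P \<and> path_connected P" if "P \<in> Q" for P
  proof (cases "P \<in> S")
    case True
    then obtain g where "arc g" "path_image g = P" using plane_graph_arc[OF assms(1)] by metis
    then show ?thesis
      using closed_arc_image arc_imp_path path_connected_path_image by metis
  next
    case False then show ?thesis using that unfolding Q_def by auto
  qed
  moreover have "finite Q" using plane_graph_finite[OF assms(1)] unfolding Q_def by auto
  ultimately show thesis
    using closed_separation_of_path_components[of Q u v] assms that unfolding UQ by auto
qed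

text \<open>Merges the two cases for a new arc. Quantifying over all points of
  \<open>A \<inter> W\<close> expresses that the ends were already connected without choosing a
  parametrisation.\<close>

lemma plane_graph_split:
  assumes "plane_graph W (insert A S)" "A \<notin> S"
  obtains C F where "C \<in> faces W S" "A - W \<subseteq> C" "faces W (insert A S) = faces W S - {C} \<union> F"
     "F \<inter> faces W S = {}" "\<And>f. f \<in> F \<Longrightarrow> A \<subseteq> closure f"
     "card F = (if \<forall>p\<in>A\<inter>W. \<forall>q\<in>A\<inter>W. path_component (W \<union> \<Union>S) p q then 2 else 1)"
proof -
  obtain g where g: "arc g" "path_image g = A" "A \<inter> W = {pathstart g, pathfinish g}"
    "new_arc (W \<union> \<Union>S) g" "A - W = A - (W \<union> \<Union>S)"
    using plane_graph_new_arc[OF assms] by blast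
  interpret new_arc "W \<union> \<Union>S" g by fact
  let ?K = "W \<union> \<Union>S" and ?p = "pathstart g" and ?q = "pathfinish g"
  have pg: "plane_graph W S" using plane_graph_subset[OF assms(1)] by blast
  have W: "?p \<in> W" "?q \<in> W" using g by auto
  have eq: "(\<forall>p\<in>A\<inter>W. \<forall>q\<in>A\<inter>W. path_component ?K p q) \<longleftrightarrow> path_component ?K ?p ?q"
    using W unfolding g(3) by (auto simp: path_component_refl path_component_sym)
  have "\<exists>C F. C \<in> components (- ?K) \<and> A - ?K \<subseteq> C \<and>
     components (- (?K \<union> A)) = components (- ?K) - {C} \<union> F \<and>
     F \<inter> components (- ?K) = {} \<and> card F = (if path_component ?K ?p ?q then 2 else 1) \<and>
     (\<forall>f\<in>F. A \<subseteq> closure f)"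
  proof (cases "path_component ?K ?p ?q")
    case True
    then show ?thesis using split_connected[OF True] g(2) by simp
  next
    case False
    obtain K1 K2 where K: "?K = K1 \<union> K2" "closed K1" "closed K2" "K1 \<inter> K2 = {}" "?p \<in> K1" "?q \<in> K2"
      using plane_graph_separation[OF pg W False] by blast
    show ?thesis using split_disconnected[OF K] g(2) False by simp
  qed
  moreover have "W \<union> \<Union>(insert A S) = ?K \<union> A" by auto
  ultimately show thesis using that g(5) unfolding faces_def eq by metis
qed

section \<open>Euler's inequality by adding edges one at a time\<close>

lemma card_image_coarser:
  assumes "finite W" "\<And>x y. x \<in> W \<Longrightarrow> y \<in> W \<Longrightarrow> r x = r y \<Longrightarrow> s x = s y"
  shows "card (s ` W) \<le> card (r ` W)"
    and "u \<in> W \<Longrightarrow> v \<in> W \<Longrightarrow> r u \<noteq> r v \<Longrightarrow> s u = s v \<Longrightarrow> card (s ` W) < card (r ` W)"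
proof -
  define h where "h c = s (SOME x. x \<in> W \<and> r x = c)" for c
  have h: "h (r x) = s x" if "x \<in> W" for x
  proof -
    have "(SOME y. y \<in> W \<and> r y = r x) \<in> W \<and> r (SOME y. y \<in> W \<and> r y = r x) = r x"
      by (rule someI[of _ x]) (simp add: that)
    then show ?thesis unfolding h_def using assms(2) that by blast
  qed
  then have "s ` W = h ` (r ` W)" by (force simp: image_image)
  then show "card (s ` W) \<le> card (r ` W)" using assms(1) card_image_le by (metis finite_imageI)
  assume uv: "u \<in> W" "v \<in> W" "r u \<noteq> r v" "s u = s v"
  have "s ` W \<subseteq> h ` (r ` W - {r v})"
  proof
    fix z assume "z \<in> s ` W"
    then obtain x where x: "x \<in> W" "z = s x" by auto
    show "z \<in> h ` (r ` W - {r v})"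
    proof (cases "r x = r v")
      case True
      then have "z = h (r u)" using x uv assms(2) h by metis
      then show ?thesis using uv by blast
    next
      case False then show ?thesis using x h by force
    qed
  qed
  then have "card (s ` W) \<le> card (r ` W - {r v})"
    using surj_card_le assms(1) by (metis finite_Diff finite_imageI)
  also have "\<dots> < card (r ` W)" using assms(1) uv by (intro psubset_card_mono) auto
  finally show "card (s ` W) < card (r ` W)" .
qed

text \<open>Counting the path components that contain vertices makes the induction work without
  connectivity: a new arc either adds a face or merges two of these components.\<close>

lemma plane_graph_euler_aux:
  assumes "finite S" "plane_graph W S"
  shows "finite (faces W S) \<and>
    card S + card (path_component_set (W \<union> \<Union>S) ` W) + 1 \<le> card (faces W S) + card W"
  using assms
proof (induction S rule: finite_induct)
  case empty
  have fW: "finite W" using plane_graph_finite empty by blast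
  have "connected (UNIV - W)"
    using fW by (intro connected_open_delete_finite) auto
  moreover have "UNIV - W \<noteq> {}" using fW infinite_UNIV_char_0 by (metis Diff_eq_empty_iff finite_subset)
  ultimately have "faces W {} = {- W}"
    unfolding faces_def by (simp add: Compl_eq_Diff_UNIV components_eq_sing_iff)
  then show ?case using card_image_le[OF fW] by simp
next
  case (insert A S)
  have fW: "finite W" using plane_graph_finite insert(4) by blast
  have pg: "plane_graph W S" using plane_graph_subset[OF insert(4)] by blast
  let ?K = "W \<union> \<Union>S" and ?L = "W \<union> \<Union>(insert A S)"
  obtain g where g: "arc g" "path_image g = A" "A \<inter> W = {pathstart g, pathfinish g}"
    using plane_graph_arc[OF insert(4) insertI1] by metis
  obtain C F where CF: "C \<in> faces W S" "faces W (insert A S) = faces W S - {C} \<union> F" "F \<inter> faces W S = {}"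
    and cF: "card F = (if \<forall>p\<in>A\<inter>W. \<forall>q\<in>A\<inter>W. path_component ?K p q then 2 else 1)"
    using plane_graph_split[OF insert(4,2)] by metis
  have fF: "finite F" using cF by (metis card.infinite one_neq_zero zero_neq_numeral)
  have IH: "finite (faces W S)" "card S + card (path_component_set ?K ` W) + 1 \<le> card (faces W S) + card W"
    using insert.IH pg by auto
  have fin: "finite (faces W (insert A S))" using CF fF IH by simp
  have card: "card (faces W (insert A S)) + 1 = card (faces W S) + card F"
  proof -
    have "card (faces W S - {C} \<union> F) = card (faces W S - {C}) + card F"
      using CF(3) fF IH by (intro card_Un_disjoint) auto
    then show ?thesis using CF(1,2) IH by (simp add: card_gt_0_iff) (metis Suc_pred card_gt_0_iff empty_iff)
  qed
  have coarser: "path_component_set ?L x = path_component_set ?L y"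
    if "x \<in> W" "y \<in> W" "path_component_set ?K x = path_component_set ?K y" for x y
  proof -
    have "path_component ?K x y" using that path_component_eq_eq path_component_refl by (metis UnI1 mem_Collect_eq)
    then have "path_component ?L x y" by (rule path_component_of_subset[rotated]) auto
    then show ?thesis by (metis path_component_eq mem_Collect_eq)
  qed
  have cS: "card (insert A S) = card S + 1" using insert(1,2) by simp
  note cc = card_image_coarser[OF fW, of "path_component_set ?K" "path_component_set ?L", OF coarser]
  show ?case
  proof (cases "\<forall>p\<in>A\<inter>W. \<forall>q\<in>A\<inter>W. path_component ?K p q")
    case True
    then have "card F = 2" using cF by simp
    then show ?thesis using fin card IH(2) cc(1) cS by linarith
  next
    case False
    then have "card F = 1" using cF by simp
    obtain p q where pq: "p \<in> A" "p \<in> W" "q \<in> A" "q \<in> W" "\<not> path_component ?K p q" using False by blast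
    have "path_component ?K q q" using pq by (simp add: path_component_refl)
    then have "path_component_set ?K p \<noteq> path_component_set ?K q" using pq(5) by blast
    moreover have "path_component_set ?L p = path_component_set ?L q"
    proof -
      have "path_connected A" using g arc_imp_path path_connected_path_image by metis
      then have "path_component A p q" using pq unfolding path_connected_component by blast
      then have "path_component ?L p q" by (rule path_component_of_subset[rotated]) auto
      then show ?thesis by (metis path_component_eq mem_Collect_eq)
    qed
    ultimately have "card (path_component_set ?L ` W) < card (path_component_set ?K ` W)"
      using cc(2) pq by blast
    then show ?thesis using fin card IH(2) \<open>card F = 1\<close> cS by linarith
  qed
qed

lemma plane_graph_euler:
  assumes "plane_graph W S" "W \<noteq> {}"
  shows "finite (faces W S)" "card S + 2 \<le> card (faces W S) + card W"
proof -
  have fin: "finite S" "finite W" using plane_graph_finite[OF assms(1)] by auto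
  have "card (path_component_set (W \<union> \<Union>S) ` W) \<noteq> 0" using assms(2) fin by simp
  then show "finite (faces W S)" "card S + 2 \<le> card (faces W S) + card W"
    using plane_graph_euler_aux[OF fin(1) assms(1)] by auto
qed

section \<open>Faces along an edge and cycles on face boundaries\<close>

text \<open>Regard \<open>A\<close> as the arc added last. The faces created by it have all of
  \<open>A\<close> in their closure, while the old faces miss the open component \<open>C\<close>
  around \<open>A - W\<close>, and so do their closures. For a bridge
  \<open>f1 = f2\<close>.\<close>

lemma plane_graph_incident_faces:
  assumes "plane_graph W S" "A \<in> S"
  obtains f1 f2 where "{f \<in> faces W S. incident W A f} = {f1, f2}" "A \<subseteq> closure f1" "A \<subseteq> closure f2"
proof -
  have S: "insert A (S - {A}) = S" "A \<notin> S - {A}" using assms by auto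
  then have pg: "plane_graph W (insert A (S - {A}))" using assms by simp
  obtain g where g: "arc g" "path_image g = A" "A \<inter> W = {pathstart g, pathfinish g}"
    using plane_graph_arc[OF assms] by metis
  obtain C F where CF: "C \<in> faces W (S - {A})" "A - W \<subseteq> C" "faces W S = faces W (S - {A}) - {C} \<union> F"
     "F \<inter> faces W (S - {A}) = {}" "\<And>f. f \<in> F \<Longrightarrow> A \<subseteq> closure f" "card F = 1 \<or> card F = 2"
    using plane_graph_split[OF pg S(2)] unfolding S(1) by metis
  have ne: "A - W \<noteq> {}"
  proof -
    have "A - W = path_image g - {pathstart g, pathfinish g}" using g by auto
    then show ?thesis using arc_minus_ends(2)[OF g(1)] by simp
  qed
  have "closed (W \<union> \<Union>(S - {A}))"
    using plane_graph_compact plane_graph_subset[OF assms(1)] compact_imp_closed by blast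
  then have opC: "open C" using CF(1) open_components unfolding faces_def by blast
  have "f \<in> F" if f: "f \<in> faces W S" "incident W A f" for f
  proof (rule ccontr)
    assume "f \<notin> F"
    then have "f \<in> faces W (S - {A}) - {C}" using f CF(3) by blast
    then have "f \<inter> C = {}" using CF(1) components_nonoverlap unfolding faces_def by blast
    then have "closure f \<inter> C = {}" using opC by (simp add: open_Int_closure_eq_empty inf_commute)
    then show False using f(2) CF(2) unfolding incident_def by blast
  qed
  moreover have "incident W A f" if "f \<in> F" for f
    using CF(5)[OF that] ne unfolding incident_def by blast
  ultimately have eq: "{f \<in> faces W S. incident W A f} = F" using CF(3) by blast
  obtain f1 f2 where "F = {f1, f2}"
  proof (cases "card F = 1")
    case True
    then obtain f where "F = {f}" by (rule card_1_singletonE)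
    then show thesis using that[of f f] by simp
  next
    case False
    then have "card F = 2" using CF(6) by simp
    then show thesis using that unfolding card_2_iff by metis
  qed
  then show thesis using that[of f1 f2] eq CF(5)[of f1] CF(5)[of f2] by simp
qed

text \<open>The hypothesis says that \<open>H\<close> is a forest: every nonempty subset has an edge
  with a free end. Such an edge meets the others in at most one point, so Janiszewski's theorem lets
  it be restored without separating the plane.\<close>

lemma connected_complement_prunable:
  assumes "finite H" "plane_graph W H"
    and "\<And>T. T \<subseteq> H \<Longrightarrow> T \<noteq> {} \<Longrightarrow> \<exists>A\<in>T. \<exists>p\<in>A \<inter> W. \<forall>B\<in>T. B \<noteq> A \<longrightarrow> p \<notin> B"
  shows "connected (- \<Union>H)"
  using assms
proof (induction H rule: finite_psubset_induct)
  case (psubset H)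
  show ?case
  proof (cases "H = {}")
    case True then show ?thesis by (simp add: connected_UNIV)
  next
    case False
    obtain A p where A: "A \<in> H" "p \<in> A" "p \<in> W" "\<And>B. B \<in> H \<Longrightarrow> B \<noteq> A \<Longrightarrow> p \<notin> B"
      using psubset.prems(2)[of H] False by blast
    have pg: "plane_graph W (H - {A})" using plane_graph_subset[OF psubset.prems(1)] by blast
    have c: "connected (- \<Union>(H - {A}))"
    proof (rule psubset.IH)
      show "H - {A} \<subset> H" using A by blast
      show "plane_graph W (H - {A})" by fact
      show "\<exists>B\<in>T. \<exists>p\<in>B \<inter> W. \<forall>D\<in>T. D \<noteq> B \<longrightarrow> p \<notin> D" if "T \<subseteq> H - {A}" "T \<noteq> {}" for T
        using psubset.prems(2)[of T] that by blast
    qed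
    obtain g where g: "arc g" "path_image g = A" "A \<inter> W = {pathstart g, pathfinish g}"
      using plane_graph_arc[OF psubset.prems(1) A(1)] by metis
    have "A \<inter> B \<subseteq> A \<inter> W - {p}" if "B \<in> H - {A}" for B
      using plane_graph_arc_Int[OF psubset.prems(1) A(1), of B] A that by blast
    then have "A \<inter> \<Union>(H - {A}) \<subseteq> A \<inter> W - {p}" by blast
    moreover have "\<exists>q. A \<inter> W - {p} \<subseteq> {q}"
    proof -
      have "p \<in> {pathstart g, pathfinish g}" using A(2,3) g(3) by blast
      then consider "p = pathstart g" | "p = pathfinish g" by blast
      then show ?thesis unfolding g(3) by cases blast+
    qed
    ultimately obtain q where "A \<inter> \<Union>(H - {A}) \<subseteq> {q}" by (meson subset_trans)
    then have q: "\<Union>(H - {A}) \<inter> A \<subseteq> {q}" by (simp add: Int_commute)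
    then have "\<Union>(H - {A}) \<inter> A = {} \<or> \<Union>(H - {A}) \<inter> A = {q}" by blast
    then have "connected (\<Union>(H - {A}) \<inter> A)" by auto
    moreover have "compact (\<Union>(H - {A}))"
    proof (rule compact_Union)
      show "finite (H - {A})" using psubset by simp
      show "compact B" if "B \<in> H - {A}" for B
        using that plane_graph_arc[OF psubset.prems(1)] compact_arc_image by (metis DiffD1)
    qed
    moreover have "closed A" "connected (- A)"
      using g closed_arc_image connected_arc_complement[OF g(1)] by auto
    ultimately have "connected (- (\<Union>(H - {A}) \<union> A))" using c by (intro Janiszewski_connected)
    moreover have "\<Union>(H - {A}) \<union> A = \<Union>H" using A by blast
    ultimately show ?thesis by simp
  qed
qed

text \<open>Without such a \<open>T\<close> the edges bordering \<open>f\<close> would form a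
  forest, whose complement is connected even after deleting the vertices. There \<open>f\<close> is
  open and relatively closed, hence everything, which leaves no room for \<open>f'\<close>.\<close>

lemma plane_graph_face_cycle:
  assumes "plane_graph W S" "f \<in> faces W S" "f' \<in> faces W S" "f' \<noteq> f"
  obtains T where "T \<subseteq> {A \<in> S. incident W A f}" "T \<noteq> {}"
    "\<And>A p. A \<in> T \<Longrightarrow> p \<in> A \<inter> W \<Longrightarrow> \<exists>B\<in>T. B \<noteq> A \<and> p \<in> B"
proof (rule ccontr)
  note wit = that
  assume no: "\<not> thesis"
  define H where "H = {A \<in> S. incident W A f}"
  let ?K = "W \<union> \<Union>S"
  have "H \<subseteq> S" unfolding H_def by simp
  then have pg: "plane_graph W H" using plane_graph_subset[OF assms(1)] by simp
  have fin: "finite H" "finite W" using plane_graph_finite[OF pg] by auto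
  have "connected (- \<Union>H)"
  proof (rule connected_complement_prunable[OF fin(1) pg])
    show "\<exists>A\<in>T. \<exists>p\<in>A \<inter> W. \<forall>B\<in>T. B \<noteq> A \<longrightarrow> p \<notin> B" if "T \<subseteq> H" "T \<noteq> {}" for T
    proof (rule ccontr)
      assume "\<not> ?thesis"
      then have "\<exists>B\<in>T. B \<noteq> A \<and> p \<in> B" if "A \<in> T" "p \<in> A \<inter> W" for A p using that by auto
      then show False using wit[OF that[unfolded H_def]] no by simp
    qed
  qed
  moreover have "open (- \<Union>H)"
  proof -
    have "closed A" if "A \<in> H" for A
      using that plane_graph_arc[OF pg] closed_arc_image by metis
    then show ?thesis using fin by (simp add: closed_Union open_Compl)
  qed
  ultimately have conn: "connected (- \<Union>H - W)"
    using fin by (intro connected_open_delete_finite) auto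
  have opf: "open f" using assms(2) plane_graph_compact[OF assms(1)] open_components compact_imp_closed
    unfolding faces_def by blast
  have f: "f \<subseteq> - ?K" "connected f" "f \<noteq> {}"
    using assms(2) in_components_subset in_components_connected in_components_nonempty unfolding faces_def by blast+
  have f': "f' \<subseteq> - ?K" "f' \<inter> f = {}" "f' \<noteq> {}"
    using assms in_components_subset in_components_nonempty components_nonoverlap unfolding faces_def by blast+
  \<comment> \<open>An edge through such a point would be incident with \<open>f\<close> and belong
    to \<open>H\<close>. So the point is off the graph, and \<open>f\<close> absorbs it by
    maximality.\<close>
  have cl: "closure f \<inter> (- \<Union>H - W) \<subseteq> f"
  proof
    fix z assume z: "z \<in> closure f \<inter> (- \<Union>H - W)"
    have "z \<in> - ?K"
    proof (rule ccontr)
      assume "z \<notin> - ?K"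
      then obtain A where "A \<in> S" "z \<in> A" using z by blast
      then show False using z unfolding H_def incident_def by blast
    qed
    moreover have "connected (insert z f)"
    proof (rule connected_intermediate_closure[OF f(2)])
      show "f \<subseteq> insert z f" by (rule subset_insertI)
      show "insert z f \<subseteq> closure f" using z closure_subset[of f] by simp
    qed
    ultimately have "insert z f \<subseteq> f"
      using f assms(2) components_maximal[of f "- ?K" "insert z f"] unfolding faces_def by blast
    then show "z \<in> f" by blast
  qed
  \<comment> \<open>deleting the edges off the boundary of \<open>f\<close> leaves \<open>f\<close> a face, so it must now be the only one\<close>
  have HS: "- ?K \<subseteq> - \<Union>H - W" unfolding H_def by blast
  have "f \<inter> (- \<Union>H - W) = {} \<or> - closure f \<inter> (- \<Union>H - W) = {}"
    using cl closure_subset[of f] by (intro connectedD[OF conn opf]) auto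
  moreover have "f \<inter> (- \<Union>H - W) \<noteq> {}" using f HS by blast
  ultimately have "- \<Union>H - W \<subseteq> f" using cl by blast
  then show False using f' HS by blast
qed

subsection \<open>The sectors at a crossing\<close>

text \<open>In the chart \<open>k\<close> the graph looks like the two axes, with the positive real
  axis on \<open>A\<close>. Any face incident with \<open>A\<close> has all of \<open>A\<close> in
  its closure, hence meets the right half-disc, which off the axis consists of the two given
  quadrants.\<close>

lemma half_axis_faces:
  assumes pg: "plane_graph W S" and A: "A \<in> S" and r: "0 < r"
    and k: "continuous_on (ball 0 r) k"
    and opn: "\<And>N. open N \<Longrightarrow> N \<subseteq> ball 0 r \<Longrightarrow> open (k ` N)"
    and K: "\<And>z. z \<in> ball 0 r \<Longrightarrow> k z \<in> W \<union> \<Union>S \<longleftrightarrow> Re z = 0 \<or> Im z = 0"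
    and axis: "\<And>t. 0 < t \<Longrightarrow> t < r \<Longrightarrow> k (of_real t) \<in> A - W"
    and f1: "f1 \<in> faces W S" "k ` {z \<in> ball 0 r. 0 < Re z \<and> 0 < Im z} \<subseteq> f1"
    and f2: "f2 \<in> faces W S" "k ` {z \<in> ball 0 r. 0 < Re z \<and> Im z < 0} \<subseteq> f2"
  shows "{f \<in> faces W S. incident W A f} = {f1, f2}"
proof -
  define z0 :: complex where "z0 = of_real (r / 2)"
  have z0: "k z0 \<in> A - W" "z0 \<in> ball 0 r" "Re z0 > 0" "Im z0 = 0"
    using axis[of "r / 2"] r unfolding z0_def by auto
  \<comment> \<open>The sign of \<open>s\<close> selects the upper or the lower quadrant, so one
    argument serves for both.\<close>
  have inc: "incident W A f" if f: "k ` {z \<in> ball 0 r. 0 < Re z \<and> 0 < s * Im z} \<subseteq> f" and s: "s \<noteq> 0" for f s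
  proof -
    let ?Q = "{z \<in> ball 0 r. 0 < Re z \<and> 0 < s * Im z}"
    have "z0 \<in> closure ?Q"
      unfolding closure_approachable
    proof (intro allI impI)
      fix e :: real assume e: "0 < e"
      define d where "d = min e (r / 2) / 2"
      define w where "w = Complex (r / 2) (sgn s * d)"
      have d: "0 < d" "d < e" "d < r / 2" using e r unfolding d_def by auto
      have "w - z0 = Complex 0 (sgn s * d)" unfolding w_def z0_def by (simp add: complex_eq_iff)
      then have "norm (w - z0) = d" using s d by (simp add: cmod_def abs_mult sgn_if)
      moreover have "norm w \<le> norm (w - z0) + norm z0" by (metis diff_add_cancel norm_triangle_ineq)
      moreover have "norm z0 = r / 2" using r unfolding z0_def by simp
      moreover have "0 < Re w" "0 < s * Im w" using r s d unfolding w_def by (auto simp: sgn_if zero_less_mult_iff)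
      ultimately show "\<exists>y\<in>?Q. dist y z0 < e" using d by (intro bexI[of _ w]) (auto simp: dist_norm)
    qed
    then obtain xs where xs: "\<And>n. xs n \<in> ?Q" "xs \<longlonglongrightarrow> z0" unfolding closure_sequential by blast
    have "(\<lambda>n. k (xs n)) \<longlonglongrightarrow> k z0"
      using continuous_on_tendsto_compose[OF k xs(2) z0(2)] xs(1) by auto
    moreover have "\<And>n. k (xs n) \<in> f" using f xs(1) by blast
    ultimately have "k z0 \<in> closure f" unfolding closure_sequential by (intro exI[of _ "\<lambda>n. k (xs n)"]) simp
    then show ?thesis using z0(1) unfolding incident_def by blast
  qed
  have "incident W A f1" using inc[of 1 f1] f1(2) by simp
  moreover have "incident W A f2" using inc[of "-1" f2] f2(2) by simp
  moreover have "f = f1 \<or> f = f2" if f: "f \<in> faces W S" "incident W A f" for f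
  proof -
    obtain g1 g2 where g: "{f \<in> faces W S. incident W A f} = {g1, g2}" "A \<subseteq> closure g1" "A \<subseteq> closure g2"
      using plane_graph_incident_faces[OF pg A] by metis
    have "f \<in> {g1, g2}" unfolding g(1)[symmetric] using f by simp
    then have "A \<subseteq> closure f" using g(2,3) by auto
    then have "k z0 \<in> closure f" using z0 by auto
    moreover have "open (k ` {z \<in> ball 0 r. 0 < Re z})"
    proof (rule opn)
      have "{z \<in> ball 0 r. 0 < Re z} = ball 0 r \<inter> {z. 0 < Re z}" by auto
      then show "open {z \<in> ball 0 r. 0 < Re z}" by (simp add: open_Int open_halfspace_Re_gt)
    qed auto
    moreover have "k z0 \<in> k ` {z \<in> ball 0 r. 0 < Re z}" using z0 by blast
    ultimately have "k ` {z \<in> ball 0 r. 0 < Re z} \<inter> f \<noteq> {}"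
      using open_Int_closure_eq_empty by blast
    then obtain w where w: "w \<in> ball 0 r" "0 < Re w" "k w \<in> f" by blast
    have "k w \<notin> W \<union> \<Union>S" using f(1) w(3) in_components_subset unfolding faces_def by blast
    then have "Im w \<noteq> 0" using K[OF w(1)] by simp
    then have "k w \<in> f1 \<or> k w \<in> f2" using w f1(2) f2(2) by (cases "0 < Im w") force+
    then show ?thesis
      using w(3) f(1) f1(1) f2(1) components_nonoverlap unfolding faces_def by blast
  qed
  ultimately show ?thesis using f1(1) f2(1) by blast
qed

text \<open>A crossing only describes the union of the two halves of an edge; this matches half-axes
  with halves. A ray is connected and avoids the only common point \<open>x\<close>, so it lies in
  one half; both rays cannot lie in the same half because the other one accumulates at
  \<open>x\<close>.\<close>

lemma rays_in_two_arcs: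
  assumes cl: "closed A1" "closed A2" "A1 \<inter> A2 = {x}"
    and R: "connected R1" "connected R2" "R1 \<subseteq> A1 \<union> A2 - {x}" "R2 \<subseteq> A1 \<union> A2 - {x}"
    and N: "open N" "x \<in> N" "N \<inter> (A1 \<union> A2) \<subseteq> R1 \<union> R2 \<union> {x}"
    and lim: "x \<in> closure (A1 - {x})" "x \<in> closure (A2 - {x})"
  shows "R1 \<subseteq> A1 \<and> R2 \<subseteq> A2 \<or> R1 \<subseteq> A2 \<and> R2 \<subseteq> A1"
proof -
  have one: "R \<subseteq> A1 \<or> R \<subseteq> A2" if R: "connected R" "R \<subseteq> A1 \<union> A2 - {x}" for R
  proof -
    have "A1 \<inter> A2 \<inter> R = {}" "R \<subseteq> A1 \<union> A2" using cl(3) R(2) by blast+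
    then have "A1 \<inter> R = {} \<or> A2 \<inter> R = {}"
      using R(1) cl(1,2) connected_closedD by blast
    then show ?thesis using R(2) by blast
  qed
  have no: "\<not> (R1 \<subseteq> A \<and> R2 \<subseteq> A)" if A: "A \<inter> B = {x}" "A \<union> B = A1 \<union> A2" "x \<in> closure (B - {x})" for A B
  proof
    assume "R1 \<subseteq> A \<and> R2 \<subseteq> A"
    moreover have "N \<inter> (B - {x}) \<noteq> {}"
      using N(1,2) A(3) open_Int_closure_eq_empty by blast
    ultimately show False using A(1,2) N(3) by blast
  qed
  have "\<not> (R1 \<subseteq> A1 \<and> R2 \<subseteq> A1)" using no[of A1 A2] cl(3) lim by simp
  moreover have "\<not> (R1 \<subseteq> A2 \<and> R2 \<subseteq> A2)" using no[of A2 A1] cl(3) lim by (simp add: Int_commute Un_commute)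
  ultimately show ?thesis using one[OF R(1,3)] one[OF R(2,4)] by blast
qed

text \<open>The arms \<open>a0\<close>, \<open>a1\<close>, \<open>a2\<close>, \<open>a3\<close> are
  the right, upper, left and lower half-axes of the chart, and \<open>g0\<close> to
  \<open>g3\<close> are the faces containing the quadrants, counterclockwise from the first. These
  faces need not be distinct.\<close>

lemma crossing_sectors:
  assumes pg: "plane_graph W S" and x: "x \<in> W"
    and S: "A1 \<in> S" "A2 \<in> S" "B1 \<in> S" "B2 \<in> S"
    and only: "\<And>D. D \<in> S \<Longrightarrow> x \<in> D \<Longrightarrow> D \<in> {A1, A2, B1, B2}"
    and AB: "A1 \<inter> A2 = {x}" "B1 \<inter> B2 = {x}"
    and cross: "crosses_at (A1 \<union> A2) (B1 \<union> B2) x"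
  obtains a0 a1 a2 a3 g0 g1 g2 g3 where
    "a0 = A1 \<and> a2 = A2 \<or> a0 = A2 \<and> a2 = A1" "a1 = B1 \<and> a3 = B2 \<or> a1 = B2 \<and> a3 = B1"
    "{f \<in> faces W S. incident W a0 f} = {g0, g3}"
    "{f \<in> faces W S. incident W a1 f} = {g1, g0}"
    "{f \<in> faces W S. incident W a2 f} = {g2, g1}"
    "{f \<in> faces W S. incident W a3 f} = {g3, g2}"
proof -
  let ?K = "W \<union> \<Union>S" and ?A = "A1 \<union> A2" and ?B = "B1 \<union> B2"
  obtain U h k where U: "open U" "x \<in> U" "homeomorphism U (ball 0 1) h k" "h x = 0"
    "h ` (U \<inter> ?A) = {z \<in> ball 0 1. Im z = 0}" "h ` (U \<inter> ?B) = {z \<in> ball 0 1. Re z = 0}"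
    using cross unfolding crosses_at_def by (elim exE conjE) (rule that)
  have hk: "\<And>u. u \<in> U \<Longrightarrow> k (h u) = u" "\<And>z. z \<in> ball 0 1 \<Longrightarrow> h (k z) = z"
    "\<And>z. z \<in> ball 0 1 \<Longrightarrow> k z \<in> U" "continuous_on (ball 0 1) k" "continuous_on U h"
    using U(3) unfolding homeomorphism_def by auto
  have k0: "k 0 = x" using hk(1)[OF U(2)] U(4) by simp
  have closedS: "closed D" if "D \<in> S" for D
    using plane_graph_arc[OF pg that] closed_arc_image by metis
  \<comment> \<open>Everything in the graph that stays away from \<open>x\<close>. It is closed, so
    a smaller disc of radius \<open>r\<close> shows nothing but the four arms.\<close>
  define R where "R = \<Union>{D \<in> S. x \<notin> D} \<union> (W - {x})"
  have "closed R" unfolding R_def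
    using plane_graph_finite[OF pg] closedS by (intro closed_Un closed_Union finite_imp_closed) auto
  then have "open (- R)" by (rule open_Compl)
  moreover have "x \<notin> R" unfolding R_def by auto
  ultimately have "open (ball 0 1 \<inter> k -` (- R))" "0 \<in> ball 0 1 \<inter> k -` (- R)"
    using continuous_open_preimage[OF hk(4)] k0 by auto
  then obtain r where r: "0 < r" "ball 0 r \<subseteq> ball 0 1 \<inter> k -` (- R)"
    unfolding open_contains_ball by blast
  have rb: "z \<in> ball 0 1" "k z \<notin> R" if "z \<in> ball 0 r" for z using r(2) that by auto
  have kA: "k z \<in> ?A \<longleftrightarrow> Im z = 0" if "z \<in> ball 0 r" for z
  proof
    assume "k z \<in> ?A"
    then have "h (k z) \<in> h ` (U \<inter> ?A)" using hk(3) rb(1)[OF that] by blast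
    then show "Im z = 0" unfolding U(5) using hk(2) rb(1)[OF that] by simp
  next
    assume "Im z = 0"
    then have "z \<in> h ` (U \<inter> ?A)" unfolding U(5) using rb(1)[OF that] by simp
    then show "k z \<in> ?A" using hk(1) by auto
  qed
  have kB: "k z \<in> ?B \<longleftrightarrow> Re z = 0" if "z \<in> ball 0 r" for z
  proof
    assume "k z \<in> ?B"
    then have "h (k z) \<in> h ` (U \<inter> ?B)" using hk(3) rb(1)[OF that] by blast
    then show "Re z = 0" unfolding U(6) using hk(2) rb(1)[OF that] by simp
  next
    assume "Re z = 0"
    then have "z \<in> h ` (U \<inter> ?B)" unfolding U(6) using rb(1)[OF that] by simp
    then show "k z \<in> ?B" using hk(1) by auto
  qed
  have kx: "k z = x \<Longrightarrow> z = 0" if "z \<in> ball 0 r" for z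
    using hk(2)[OF rb(1)[OF that]] U(4) by auto
  have kW: "k z \<in> W \<longleftrightarrow> z = 0" if "z \<in> ball 0 r" for z
    using kx[OF that] rb(2)[OF that] k0 x unfolding R_def by auto
  have xAB: "x \<in> ?A" "x \<in> ?B" using AB by auto
  have K: "k z \<in> ?K \<longleftrightarrow> Re z = 0 \<or> Im z = 0" if z: "z \<in> ball 0 r" for z
  proof
    assume "k z \<in> ?K"
    then consider "k z \<in> W" | D where "D \<in> S" "k z \<in> D" by blast
    then show "Re z = 0 \<or> Im z = 0"
    proof cases
      case 1 then show ?thesis using kW[OF z] by simp
    next
      case 2
      then have "x \<in> D" using rb(2)[OF z] unfolding R_def by blast
      then have "k z \<in> ?A \<or> k z \<in> ?B" using only[OF 2(1)] 2(2) by blast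
      then show ?thesis using kA[OF z] kB[OF z] by blast
    qed
  next
    assume "Re z = 0 \<or> Im z = 0"
    then have "k z \<in> ?A \<or> k z \<in> ?B" using kA[OF z] kB[OF z] by blast
    then show "k z \<in> ?K" using S by blast
  qed
  have opn: "open (k ` N)" if N: "open N" "N \<subseteq> ball 0 r" for N
  proof -
    have "k ` N = U \<inter> h -` N"
    proof
      show "k ` N \<subseteq> U \<inter> h -` N" using N(2) rb(1) hk(2,3) by auto
      show "U \<inter> h -` N \<subseteq> k ` N" using hk(1) by (metis IntE image_eqI subsetI vimageE)
    qed
    then show ?thesis using continuous_open_preimage[OF hk(5) U(1) N(1)] by simp
  qed
  have contk: "continuous_on (ball 0 r) k"
    using continuous_on_subset[OF hk(4)] r(2) by blast
  define ray where "ray c = (\<lambda>t. k (c * of_real t)) ` {0<..<r}" for c :: complex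
  have ray_conn: "connected (ray c)" if c: "norm c = 1" for c
  proof -
    have "continuous_on {0<..<r} (\<lambda>t. k (c * of_real t))"
      by (rule continuous_on_compose2[OF contk]) (auto intro!: continuous_intros simp: norm_mult c)
    then show ?thesis unfolding ray_def by (rule connected_continuous_image) auto
  qed
  have inb: "c * of_real t \<in> ball 0 r" "c * of_real t \<noteq> 0" if "norm c = 1" "0 < t" "t < r" for c :: complex and t
    using that by (auto simp: norm_mult)
  have rayA: "ray c \<subseteq> ?A - {x}" if c: "c = 1 \<or> c = -1" for c
    unfolding ray_def
  proof (rule image_subsetI)
    fix t assume "t \<in> {0<..<r}"
    then have b: "c * of_real t \<in> ball 0 r" "c * of_real t \<noteq> 0" using inb[of c t] c by auto
    have "Im (c * of_real t) = 0" using c by auto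
    then show "k (c * of_real t) \<in> ?A - {x}" using kA[OF b(1)] kx[OF b(1)] b(2) by blast
  qed
  have rayB: "ray c \<subseteq> ?B - {x}" if c: "c = \<i> \<or> c = -\<i>" for c
    unfolding ray_def
  proof (rule image_subsetI)
    fix t assume "t \<in> {0<..<r}"
    then have b: "c * of_real t \<in> ball 0 r" "c * of_real t \<noteq> 0" using inb[of c t] c by auto
    have "Re (c * of_real t) = 0" using c by auto
    then show "k (c * of_real t) \<in> ?B - {x}" using kB[OF b(1)] kx[OF b(1)] b(2) by blast
  qed
  let ?N = "k ` ball 0 r"
  have N: "open ?N" "x \<in> ?N" using opn[of "ball 0 r"] k0 r(1) by force+
  have NA: "?N \<inter> ?A \<subseteq> ray 1 \<union> ray (-1) \<union> {x}"
  proof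
    fix y assume "y \<in> ?N \<inter> ?A"
    then obtain z where z: "z \<in> ball 0 r" "y = k z" "Im z = 0" using kA by blast
    then have zr: "z = of_real (Re z)" by (simp add: complex_eq_iff)
    have "\<bar>Re z\<bar> < r" using z(1) abs_Re_le_cmod[of z] by simp
    then consider "Re z = 0" | "Re z \<in> {0<..<r}" | "- Re z \<in> {0<..<r}" by force
    then show "y \<in> ray 1 \<union> ray (-1) \<union> {x}"
    proof cases
      case 1 then show ?thesis using z zr k0 by simp
    next
      case 2
      then have "k (1 * of_real (Re z)) \<in> ray 1" unfolding ray_def by (rule imageI)
      then show ?thesis using z zr by simp
    next
      case 3
      then have "k (-1 * of_real (- Re z)) \<in> ray (-1)" unfolding ray_def by (rule imageI)
      then show ?thesis using z zr by simp
    qed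
  qed
  have NB: "?N \<inter> ?B \<subseteq> ray \<i> \<union> ray (-\<i>) \<union> {x}"
  proof
    fix y assume "y \<in> ?N \<inter> ?B"
    then obtain z where z: "z \<in> ball 0 r" "y = k z" "Re z = 0" using kB by blast
    then have zr: "z = \<i> * of_real (Im z)" by (simp add: complex_eq_iff)
    have "\<bar>Im z\<bar> < r" using z(1) abs_Im_le_cmod[of z] by simp
    then consider "Im z = 0" | "Im z \<in> {0<..<r}" | "- Im z \<in> {0<..<r}" by force
    then show "y \<in> ray \<i> \<union> ray (-\<i>) \<union> {x}"
    proof cases
      case 1 then show ?thesis using z zr k0 by simp
    next
      case 2
      then have "k (\<i> * of_real (Im z)) \<in> ray \<i>" unfolding ray_def by (rule imageI)
      then show ?thesis using z zr by simp
    next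
      case 3
      then have "k (-\<i> * of_real (- Im z)) \<in> ray (-\<i>)" unfolding ray_def by (rule imageI)
      then show ?thesis using z zr by simp
    qed
  qed
  have lim: "x \<in> closure (D - {x})" if D: "D \<in> S" "x \<in> D" for D
  proof -
    obtain g where g: "arc g" "path_image g = D" "D \<inter> W = {pathstart g, pathfinish g}"
      using plane_graph_arc[OF pg D(1)] by metis
    have "x \<in> {pathstart g, pathfinish g}" using g(3) D x by blast
    then have "D - {pathstart g, pathfinish g} \<subseteq> D - {x}" by blast
    then show ?thesis using arc_minus_ends(3)[OF g(1)] closure_mono D(2) unfolding g(2) by blast
  qed
  have in1: "x \<in> A1" "x \<in> A2" "x \<in> B1" "x \<in> B2" using AB by auto
  obtain a0 a2 where a02: "a0 = A1 \<and> a2 = A2 \<or> a0 = A2 \<and> a2 = A1" "ray 1 \<subseteq> a0" "ray (-1) \<subseteq> a2"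
    using rays_in_two_arcs[OF closedS[OF S(1)] closedS[OF S(2)] AB(1) ray_conn[of 1] ray_conn[of "-1"]
        rayA rayA N NA lim[OF S(1) in1(1)] lim[OF S(2) in1(2)]] by auto
  obtain a1 a3 where a13: "a1 = B1 \<and> a3 = B2 \<or> a1 = B2 \<and> a3 = B1" "ray \<i> \<subseteq> a1" "ray (-\<i>) \<subseteq> a3"
    using rays_in_two_arcs[OF closedS[OF S(3)] closedS[OF S(4)] AB(2) ray_conn[of \<i>] ray_conn[of "-\<i>"]
        rayB rayB N NB lim[OF S(3) in1(3)] lim[OF S(4) in1(4)]] by auto
  define Q where "Q = {z \<in> ball 0 r. 0 < Re z \<and> 0 < Im z}"
  have Qne: "Q \<noteq> {}"
  proof -
    have "norm (Complex (r/3) (r/3)) \<le> r/3 + r/3" using norm_complex_def cmod_le[of "Complex (r/3) (r/3)"] r(1) by simp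
    then have "Complex (r/3) (r/3) \<in> Q" using r(1) unfolding Q_def by simp
    then show ?thesis by blast
  qed
  have Qconv: "connected Q"
  proof -
    have "Q = ball 0 r \<inter> {z. 0 < Re z} \<inter> {z. 0 < Im z}" unfolding Q_def by auto
    then have "convex Q" by (auto intro!: convex_Int convex_halfspace_Re_gt convex_halfspace_Im_gt)
    then show ?thesis by (rule convex_connected)
  qed
  define unit where "unit c \<longleftrightarrow> c = 1 \<or> c = \<i> \<or> c = -1 \<or> c = -\<i>" for c
  have "\<exists>f. f \<in> faces W S \<and> (\<lambda>z. k (c * z)) ` Q \<subseteq> f" if c: "unit c" for c
  proof -
    have nc: "norm c = 1" using c unfolding unit_def by auto
    have "continuous_on Q (\<lambda>z. k (c * z))"
      by (rule continuous_on_compose2[OF contk]) (auto intro!: continuous_intros simp: norm_mult nc Q_def)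
    then have "connected ((\<lambda>z. k (c * z)) ` Q)" using Qconv by (rule connected_continuous_image)
    moreover have sub: "(\<lambda>z. k (c * z)) ` Q \<subseteq> - ?K"
    proof (intro image_subsetI ComplI)
      fix z assume z: "z \<in> Q" "k (c * z) \<in> ?K"
      have "c * z \<in> ball 0 r" using z nc unfolding Q_def by (simp add: norm_mult)
      then have "Re (c * z) = 0 \<or> Im (c * z) = 0" using K z(2) by blast
      then show False using z(1) c unfolding Q_def unit_def by auto
    qed
    moreover have "- ?K \<noteq> {}" using sub Qne by blast
    ultimately show ?thesis using exists_component_superset unfolding faces_def by meson
  qed
  then obtain F where F: "\<And>c. unit c \<Longrightarrow> F c \<in> faces W S" "\<And>c. unit c \<Longrightarrow> (\<lambda>z. k (c * z)) ` Q \<subseteq> F c"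
    by metis
  \<comment> \<open>Rotating the chart by \<open>c\<close> moves the half-axis in direction
    \<open>c\<close> to the positive real axis. The quadrant following it is then
    \<open>F c\<close>, the one preceding it \<open>F (- \<i> * c)\<close>.\<close>
  have main: "{f \<in> faces W S. incident W a f} = {F c, F (- \<i> * c)}"
    if c: "unit c" and a: "a \<in> S" "ray c \<subseteq> a" for a c
  proof (rule half_axis_faces[OF pg a(1) r(1), of "\<lambda>z. k (c * z)"])
    have nc: "norm c = 1" using c unfolding unit_def by auto
    have uc: "unit (- \<i> * c)" using c unfolding unit_def by auto
    show "continuous_on (ball 0 r) (\<lambda>z. k (c * z))"
      by (rule continuous_on_compose2[OF contk]) (auto intro!: continuous_intros simp: norm_mult nc)
    show "open ((\<lambda>z. k (c * z)) ` M)" if M: "open M" "M \<subseteq> ball 0 r" for M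
    proof -
      have c0: "c \<noteq> 0" using nc by auto
      have "(*) c ` M = (\<lambda>z. z / c) -` M"
      proof (intro equalityI subsetI)
        fix z assume "z \<in> (\<lambda>z. z / c) -` M"
        then have "c * (z / c) \<in> (*) c ` M" by blast
        then show "z \<in> (*) c ` M" using c0 by simp
      qed (use c0 in auto)
      moreover have "open ((\<lambda>z. z / c) -` M)"
        by (rule open_vimage[OF M(1)]) (intro continuous_intros, use c0 in auto)
      ultimately have "open ((*) c ` M)" by simp
      moreover have "(*) c ` M \<subseteq> ball 0 r" using M(2) nc by (auto simp: norm_mult)
      ultimately have "open (k ` ((*) c ` M))" by (rule opn)
      then show ?thesis by (simp add: image_image)
    qed
    show "k (c * z) \<in> ?K \<longleftrightarrow> Re z = 0 \<or> Im z = 0" if z: "z \<in> ball 0 r" for z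
    proof -
      have "c * z \<in> ball 0 r" using z nc by (simp add: norm_mult)
      then have "k (c * z) \<in> ?K \<longleftrightarrow> Re (c * z) = 0 \<or> Im (c * z) = 0" by (rule K)
      then show ?thesis using c unfolding unit_def by auto
    qed
    show "k (c * of_real t) \<in> a - W" if t: "0 < t" "t < r" for t
    proof -
      have "k (c * of_real t) \<in> ray c" using t unfolding ray_def by auto
      then show ?thesis using a(2) kW inb[OF nc t] by blast
    qed
    show "F c \<in> faces W S" "F (- \<i> * c) \<in> faces W S" using F(1) c uc by auto
    show "(\<lambda>z. k (c * z)) ` {z \<in> ball 0 r. 0 < Re z \<and> 0 < Im z} \<subseteq> F c"
      using F(2)[OF c] unfolding Q_def .
    show "(\<lambda>z. k (c * z)) ` {z \<in> ball 0 r. 0 < Re z \<and> Im z < 0} \<subseteq> F (- \<i> * c)"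
    proof (rule image_subsetI)
      fix z assume "z \<in> {z \<in> ball 0 r. 0 < Re z \<and> Im z < 0}"
      then have "\<i> * z \<in> Q" unfolding Q_def by (auto simp: norm_mult)
      then have "k (- \<i> * c * (\<i> * z)) \<in> F (- \<i> * c)" using F(2)[OF uc] by blast
      moreover have "- \<i> * c * (\<i> * z) = c * z" by (simp add: complex_eq_iff algebra_simps)
      ultimately show "k (c * z) \<in> F (- \<i> * c)" by simp
    qed
  qed
  have aS: "a0 \<in> S" "a1 \<in> S" "a2 \<in> S" "a3 \<in> S" using a02(1) a13(1) S by auto
  have "unit 1" "unit \<i>" "unit (-1)" "unit (-\<i>)" unfolding unit_def by auto
  then show thesis
    using that[of a0 a2 a1 a3 "F 1" "F (-\<i>)" "F \<i>" "F (-1)", OF a02(1) a13(1)]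
      main[OF _ aS(1) a02(2)] main[OF _ aS(2) a13(2)] main[OF _ aS(3) a02(3)] main[OF _ aS(4) a13(3)]
    by simp
qed

text \<open>A quarter turn of the disc interchanges the two diameters.\<close>

lemma crosses_at_sym:
  assumes "crosses_at A B p" shows "crosses_at B A p"
proof -
  obtain U h k where U: "open U" "p \<in> U" "homeomorphism U (ball 0 1) h k" "h p = 0"
    "h ` (U \<inter> A) = {z \<in> ball 0 1. Im z = 0}" "h ` (U \<inter> B) = {z \<in> ball 0 1. Re z = 0}"
    using assms unfolding crosses_at_def by (elim exE conjE) (rule that)
  have rot: "homeomorphism (ball 0 1) (ball 0 1) ((*) \<i>) ((*) (- \<i>))"
  proof (rule homeomorphismI)
    show "continuous_on (ball 0 1) ((*) \<i>)" "continuous_on (ball 0 1) ((*) (- \<i>))"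
      by (intro continuous_intros)+
  qed (auto simp: norm_mult simp flip: mult.assoc)
  have hom: "homeomorphism U (ball 0 1) ((*) \<i> \<circ> h) (k \<circ> (*) (- \<i>))"
    using homeomorphism_compose[OF U(3) rot] .
  have "((*) \<i> \<circ> h) ` (U \<inter> B) = (*) \<i> ` {z \<in> ball 0 1. Re z = 0}"
    unfolding image_comp[symmetric] U(6) ..
  also have "\<dots> = {z \<in> ball 0 1. Im z = 0}"
  proof (intro equalityI subsetI)
    fix z :: complex assume "z \<in> {z \<in> ball 0 1. Im z = 0}"
    then have "- \<i> * z \<in> {z \<in> ball 0 1. Re z = 0}" by (auto simp: norm_mult)
    then have "\<i> * (- \<i> * z) \<in> (*) \<i> ` {z \<in> ball 0 1. Re z = 0}" by (rule imageI)
    then show "z \<in> (*) \<i> ` {z \<in> ball 0 1. Re z = 0}" by (simp flip: mult.assoc)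
  qed (auto simp: norm_mult)
  finally have 1: "((*) \<i> \<circ> h) ` (U \<inter> B) = {z \<in> ball 0 1. Im z = 0}" .
  have "((*) \<i> \<circ> h) ` (U \<inter> A) = (*) \<i> ` {z \<in> ball 0 1. Im z = 0}"
    unfolding image_comp[symmetric] U(5) ..
  also have "\<dots> = {z \<in> ball 0 1. Re z = 0}"
  proof (intro equalityI subsetI)
    fix z :: complex assume "z \<in> {z \<in> ball 0 1. Re z = 0}"
    then have "- \<i> * z \<in> {z \<in> ball 0 1. Im z = 0}" by (auto simp: norm_mult)
    then have "\<i> * (- \<i> * z) \<in> (*) \<i> ` {z \<in> ball 0 1. Im z = 0}" by (rule imageI)
    then show "z \<in> (*) \<i> ` {z \<in> ball 0 1. Im z = 0}" by (simp flip: mult.assoc)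
  qed (auto simp: norm_mult)
  finally have 2: "((*) \<i> \<circ> h) ` (U \<inter> A) = {z \<in> ball 0 1. Re z = 0}" .
  show ?thesis unfolding crosses_at_def
    using U(1,2,4) hom 1 2 by (intro exI[of _ U] exI[of _ "(*) \<i> \<circ> h"] exI[of _ "k \<circ> (*) (- \<i>)"]) simp
qed

lemma split_arc:
  fixes g :: "real \<Rightarrow> 'a::real_normed_vector"
  assumes "arc g" "x \<in> path_image g" "x \<noteq> pathstart g" "x \<noteq> pathfinish g"
  obtains g1 g2 where "arc g1" "arc g2" "pathstart g1 = pathstart g" "pathfinish g1 = x"
    "pathstart g2 = x" "pathfinish g2 = pathfinish g"
    "path_image g1 \<union> path_image g2 = path_image g" "path_image g1 \<inter> path_image g2 = {x}"
proof -
  obtain t where t: "t \<in> {0..1}" "x = g t" using assms(2) unfolding path_image_def by auto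
  have t01: "t \<noteq> 0" "t \<noteq> 1" using t assms(3,4) unfolding pathstart_def pathfinish_def by auto
  have im: "path_image (subpath 0 t g) = g ` {0..t}" "path_image (subpath t 1 g) = g ` {t..1}"
    using t by (auto simp: path_image_subpath)
  have inj: "inj_on g {0..1}" using assms(1) unfolding arc_def by simp
  show thesis
  proof (rule that[of "subpath 0 t g" "subpath t 1 g"])
    show "arc (subpath 0 t g)" "arc (subpath t 1 g)"
      using assms(1) t t01 by (auto intro!: arc_subpath_arc)
    show "pathstart (subpath 0 t g) = pathstart g" "pathfinish (subpath t 1 g) = pathfinish g"
      by (simp_all add: pathstart_def pathfinish_def subpath_def)
    show "pathfinish (subpath 0 t g) = x" "pathstart (subpath t 1 g) = x"
      using t(2) by simp_all
    have "{0..t} \<union> {t..1} = {0..1}" using t by auto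
    then show "path_image (subpath 0 t g) \<union> path_image (subpath t 1 g) = path_image g"
      unfolding im by (metis image_Un path_image_def)
    have "g ` {0..t} \<inter> g ` {t..1} = g ` ({0..t} \<inter> {t..1})"
      using t by (intro inj_on_image_Int[OF inj, symmetric]) auto
    also have "{0..t} \<inter> {t..1} = {t}" using t by auto
    finally show "path_image (subpath 0 t g) \<inter> path_image (subpath t 1 g) = {x}"
      unfolding im using t by simp
  qed
qed

subsection \<open>Discharging\<close>

text \<open>
  Around a crossing \<open>x\<close> the half-edges come in the cyclic order \<open>arm x False False\<close>,
  \<open>arm x False True\<close>, \<open>arm x True True\<close>, \<open>arm x True False\<close>, where the first index is the colour
  class of the far end (up to swapping the classes). Hence the sectors of \<open>x\<close> alternate between
  \<open>mono x i\<close>, whose two outer ends have the same colour, and \<open>alt x j\<close>, whose ends have different colours.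
\<close>

locale crossing_map =
  fixes S :: "'s set" and P :: "'v set" and \<Phi> :: "'f set"
    and ends :: "'s \<Rightarrow> 'v set" and inc :: "'s \<Rightarrow> 'f \<Rightarrow> bool" and col :: "'v \<Rightarrow> bool"
    and arm :: "'v \<Rightarrow> bool \<Rightarrow> bool \<Rightarrow> 's" and tip :: "'v \<Rightarrow> bool \<Rightarrow> bool \<Rightarrow> 'v"
    and mono :: "'v \<Rightarrow> bool \<Rightarrow> 'f" and alt :: "'v \<Rightarrow> bool \<Rightarrow> 'f"
  assumes fin: "finite S" "finite P" "finite \<Phi>"
    and card_ends: "e \<in> S \<Longrightarrow> card (ends e) = 2"
    and ends_inj: "inj_on ends S"
    and bip: "e \<in> S \<Longrightarrow> ends e = {p, q} \<Longrightarrow> p \<notin> P \<Longrightarrow> q \<notin> P \<Longrightarrow> col p \<noteq> col q"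
    and inc_faces: "e \<in> S \<Longrightarrow> \<exists>f1 f2. {f \<in> \<Phi>. inc e f} = {f1, f2}"
    and cycle: "f \<in> \<Phi> \<Longrightarrow> \<exists>T \<subseteq> {e \<in> S. inc e f}. T \<noteq> {} \<and>
       (\<forall>e\<in>T. \<forall>p\<in>ends e. \<exists>e'\<in>T. e' \<noteq> e \<and> p \<in> ends e')"
    and arm: "x \<in> P \<Longrightarrow> arm x i j \<in> S" "x \<in> P \<Longrightarrow> ends (arm x i j) = {x, tip x i j}"
      "x \<in> P \<Longrightarrow> tip x i j \<notin> P"
      "x \<in> P \<Longrightarrow> e \<in> S \<Longrightarrow> x \<in> ends e \<Longrightarrow> \<exists>i j. e = arm x i j"
    and arm_inj: "x \<in> P \<Longrightarrow> arm x i j = arm x i' j' \<Longrightarrow> i = i' \<and> j = j'"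
    and arm_faces: "x \<in> P \<Longrightarrow> {f \<in> \<Phi>. inc (arm x i j) f} = {mono x i, alt x j}"
    and tip_col: "x \<in> P \<Longrightarrow> col (tip x i j) = col (tip x i' j') \<longleftrightarrow> i = i'"
    and nic: "x \<in> P \<Longrightarrow> y \<in> P \<Longrightarrow> x \<noteq> y \<Longrightarrow> tip x i j = tip y k l \<Longrightarrow> tip x i' j' = tip y k' l' \<Longrightarrow>
       tip x i j = tip x i' j'"
begin

definition "bd f = {e \<in> S. inc e f}"
\<comment> \<open>the number of sides of \<open>e\<close> on \<open>f\<close>; a bridge has both sides on the same face\<close>
definition "sides e f = (if inc e f then if card {f \<in> \<Phi>. inc e f} = 1 then 2 else 1 else (0::nat))"
definition "face_deg f = (\<Sum>e\<in>S. sides e f)"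
text \<open>Sectors are recorded as pairs because several sectors of one crossing may lie in the
  same face and must be counted separately.\<close>

definition "monos f = {(x, i). x \<in> P \<and> mono x i = f}"
definition "alts f = {(x, i). x \<in> P \<and> alt x i = f}"

lemma face_in: "x \<in> P \<Longrightarrow> mono x i \<in> \<Phi>" "x \<in> P \<Longrightarrow> alt x j \<in> \<Phi>"
  using arm_faces by blast+

lemma arm_in_bd: "x \<in> P \<Longrightarrow> f \<in> \<Phi> \<Longrightarrow> arm x i j \<in> bd f \<longleftrightarrow> f = mono x i \<or> f = alt x j"
  using arm_faces[of x i j] arm(1) unfolding bd_def by blast

lemma arm_eq_iff:
  assumes "x \<in> P" "y \<in> P"
  shows "arm x i j = arm y k l \<longleftrightarrow> x = y \<and> i = k \<and> j = l"
proof
  assume eq: "arm x i j = arm y k l"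
  then have "{x, tip x i j} = {y, tip y k l}" using arm(2) assms by metis
  moreover have "x \<noteq> tip y k l" using arm(3) assms by metis
  ultimately have "x = y" by blast
  then show "x = y \<and> i = k \<and> j = l" using arm_inj assms(1) eq by blast
qed simp

lemma ends_other: "e \<in> S \<Longrightarrow> p \<in> ends e \<Longrightarrow> \<exists>q. q \<noteq> p \<and> ends e = {p, q}"
  using card_ends[of e] by (auto simp: card_2_iff insert_commute)

lemma same_ends: "e \<in> S \<Longrightarrow> e' \<in> S \<Longrightarrow> p \<in> ends e \<Longrightarrow> q \<in> ends e \<Longrightarrow> p \<in> ends e' \<Longrightarrow> q \<in> ends e' \<Longrightarrow>
   p \<noteq> q \<Longrightarrow> e = e'"
proof -
  assume a: "e \<in> S" "e' \<in> S" "p \<in> ends e" "q \<in> ends e" "p \<in> ends e'" "q \<in> ends e'" "p \<noteq> q"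
  have "ends d = {p, q}" if "d \<in> S" "p \<in> ends d" "q \<in> ends d" for d
    using card_ends[OF that(1)] that a(7) by (auto simp: card_2_iff)
  then show ?thesis using a ends_inj by (metis inj_onD)
qed

lemma sum_sides: "e \<in> S \<Longrightarrow> (\<Sum>f\<in>\<Phi>. sides e f) = 2"
proof -
  assume e: "e \<in> S"
  obtain f1 f2 where f: "{f \<in> \<Phi>. inc e f} = {f1, f2}" using inc_faces[OF e] by blast
  have "(\<Sum>f\<in>\<Phi>. sides e f) = (\<Sum>f\<in>{f \<in> \<Phi>. inc e f}. if card {f1, f2} = 1 then 2 else 1)"
    unfolding f[symmetric] sides_def
    using fin by (intro sum.mono_neutral_cong_right) auto
  also have "\<dots> = 2" unfolding f by (cases "f1 = f2") auto
  finally show ?thesis .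
qed

lemma sum_face_deg: "(\<Sum>f\<in>\<Phi>. face_deg f) = 2 * card S"
  unfolding face_deg_def by (subst sum.swap) (simp add: sum_sides)

lemma card_bd_le_face_deg: "card (bd f) \<le> face_deg f"
proof -
  have "card (bd f) = (\<Sum>e\<in>bd f. 1)" by simp
  also have "\<dots> \<le> (\<Sum>e\<in>bd f. sides e f)" by (rule sum_mono) (auto simp: bd_def sides_def)
  also have "\<dots> \<le> face_deg f" unfolding face_deg_def using fin by (intro sum_mono2) (auto simp: bd_def)
  finally show ?thesis .
qed

lemma finite_bd: "finite (bd f)" using fin unfolding bd_def by auto

lemma finite_sectors: "finite (monos f)" "finite (alts f)"
  using fin by (auto simp: monos_def alts_def intro: finite_subset[of _ "P \<times> UNIV"])

lemma sum_sectors: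
  assumes g: "\<And>x i. x \<in> P \<Longrightarrow> g x i \<in> \<Phi>"
  shows "(\<Sum>f\<in>\<Phi>. card {(x, i :: bool). x \<in> P \<and> g x i = f}) = 2 * card P"
proof -
  have "(\<Sum>z\<in>P \<times> (UNIV :: bool set). 1) = (\<Sum>f\<in>\<Phi>. \<Sum>z | z \<in> P \<times> UNIV \<and> case_prod g z = f. 1 :: nat)"
    using fin g by (intro sum.group[symmetric]) auto
  then have "card (P \<times> (UNIV :: bool set)) = (\<Sum>f\<in>\<Phi>. card {z \<in> P \<times> UNIV. case_prod g z = f})"
    by simp
  moreover have "{z \<in> P \<times> UNIV. case_prod g z = f} = {(x, i :: bool). x \<in> P \<and> g x i = f}" for f by auto
  ultimately show ?thesis by (simp add: card_cartesian_product)
qed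

lemma two_monos_le_card_bd:
  assumes "f \<in> \<Phi>" shows "2 * card (monos f) \<le> card (bd f)"
proof -
  have "inj_on (\<lambda>((x, i), j). arm x i j) (monos f \<times> UNIV)"
    unfolding inj_on_def monos_def by (auto simp: arm_eq_iff)
  moreover have "(\<lambda>((x, i), j). arm x i j) ` (monos f \<times> UNIV) \<subseteq> bd f"
    using arm_in_bd[OF _ assms] unfolding monos_def by auto
  ultimately have "card (monos f \<times> (UNIV :: bool set)) \<le> card (bd f)"
    using finite_bd card_inj_on_le by blast
  then show ?thesis by (simp add: card_cartesian_product)
qed

section \<open>Faces of degree three and four\<close>

text \<open>No two edges share both ends, so the further edges required at the two ends of
  \<open>e\<close> are different. This alone shows that every boundary contains three edges.\<close>

lemma cycle_start:
  assumes T: "T \<subseteq> S" "\<And>e p. e \<in> T \<Longrightarrow> p \<in> ends e \<Longrightarrow> \<exists>e'\<in>T. e' \<noteq> e \<and> p \<in> ends e'"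
    and e: "e \<in> T" "ends e = {p, q}"
  obtains e1 e2 r where "e1 \<in> T" "e2 \<in> T" "e1 \<noteq> e" "e2 \<noteq> e" "e1 \<noteq> e2" "ends e1 = {p, r}" "q \<in> ends e2"
    "r \<noteq> p" "r \<noteq> q" "p \<noteq> q" "p \<notin> ends e2"
proof -
  have "p \<noteq> q" using card_ends[of e] e T(1) by auto
  obtain e1 where e1: "e1 \<in> T" "e1 \<noteq> e" "p \<in> ends e1" using T(2)[OF e(1), of p] e(2) by auto
  obtain e2 where e2: "e2 \<in> T" "e2 \<noteq> e" "q \<in> ends e2" using T(2)[OF e(1), of q] e(2) by auto
  have p2: "p \<notin> ends e2" using same_ends[of e2 e p q] e2 e T(1) \<open>p \<noteq> q\<close> by auto
  have q1: "q \<notin> ends e1" using same_ends[of e1 e p q] e1 e T(1) \<open>p \<noteq> q\<close> by auto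
  obtain r where r: "ends e1 = {p, r}" "r \<noteq> p"
    using ends_other[of e1 p] e1 T(1) by blast
  show thesis using that[of e1 e2 r] e1 e2 p2 q1 r \<open>p \<noteq> q\<close> by auto
qed

lemma face_cycle_card:
  assumes "f \<in> \<Phi>" shows "3 \<le> card (bd f)"
proof -
  obtain T where T: "T \<subseteq> bd f" "T \<noteq> {}"
    "\<And>e p. e \<in> T \<Longrightarrow> p \<in> ends e \<Longrightarrow> \<exists>e'\<in>T. e' \<noteq> e \<and> p \<in> ends e'"
    using cycle[OF assms] unfolding bd_def by blast
  have TS: "T \<subseteq> S" using T unfolding bd_def by auto
  obtain e where e: "e \<in> T" using T by auto
  obtain p q where "ends e = {p, q}" using card_ends[of e] e TS by (auto simp: card_2_iff)
  then obtain e1 e2 where "e1 \<in> T" "e2 \<in> T" "e1 \<noteq> e" "e2 \<noteq> e" "e1 \<noteq> e2"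
    using cycle_start[OF TS T(3) e] by metis
  then have "card {e, e1, e2} \<le> card (bd f)" using e T(1) finite_bd by (intro card_mono) auto
  then show ?thesis using \<open>e1 \<noteq> e\<close> \<open>e2 \<noteq> e\<close> \<open>e1 \<noteq> e2\<close> by simp
qed

text \<open>The three edges from \<open>cycle_start\<close> already exhaust the boundary, so only
  \<open>e2\<close> can cover the far end \<open>r\<close> of \<open>e1\<close> a second
  time.\<close>

lemma triangle:
  assumes f: "card (bd f) = 3" and T: "T \<subseteq> bd f"
    "\<And>e p. e \<in> T \<Longrightarrow> p \<in> ends e \<Longrightarrow> \<exists>e'\<in>T. e' \<noteq> e \<and> p \<in> ends e'"
    and e: "e \<in> T" "ends e = {p, q}"
  obtains e1 e2 r where "T = {e, e1, e2}" "bd f = {e, e1, e2}" "ends e1 = {p, r}" "ends e2 = {q, r}"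
    "r \<noteq> p" "r \<noteq> q" "p \<noteq> q" "e1 \<noteq> e" "e2 \<noteq> e" "e1 \<noteq> e2"
proof -
  have TS: "T \<subseteq> S" using T unfolding bd_def by auto
  obtain e1 e2 r where 1: "e1 \<in> T" "e2 \<in> T" "e1 \<noteq> e" "e2 \<noteq> e" "e1 \<noteq> e2" "ends e1 = {p, r}" "q \<in> ends e2"
    "r \<noteq> p" "r \<noteq> q" "p \<noteq> q" "p \<notin> ends e2"
    using cycle_start[OF TS T(2) e] by metis
  have c3: "card {e, e1, e2} = 3" using 1 by simp
  have sub: "{e, e1, e2} \<subseteq> T" using 1 e by auto
  then have bd: "{e, e1, e2} = bd f"
    using card_subset_eq[OF finite_bd, of "{e, e1, e2}" f] c3 f T(1) by auto
  then have TT: "T = {e, e1, e2}" using sub T(1) by auto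
  obtain e' where "e' \<in> T" "e' \<noteq> e1" "r \<in> ends e'" using T(2)[of e1 r] 1 by auto
  then have "r \<in> ends e2" using TT e(2) 1 by auto
  then have "ends e2 = {q, r}" using ends_other[of e2 q] 1 TS by auto
  then show thesis using that[of e1 e2 r, OF TT bd[symmetric]] 1 by simp
qed

text \<open>Three vertices outside \<open>P\<close> would form an odd cycle. So two of the edges are
  arms of a crossing \<open>x\<close>, and the third joins their tips, which therefore differ in
  colour. A monochromatic sector would put two arms with the same first index on the
  boundary.\<close>

lemma face_degree_3:
  assumes f: "f \<in> \<Phi>" "card (bd f) = 3"
  shows "monos f = {}" "alts f \<noteq> {}"
proof -
  obtain T where T: "T \<subseteq> bd f" "T \<noteq> {}"
    "\<And>e p. e \<in> T \<Longrightarrow> p \<in> ends e \<Longrightarrow> \<exists>e'\<in>T. e' \<noteq> e \<and> p \<in> ends e'"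
    using cycle[OF f(1)] unfolding bd_def by blast
  have bdS: "bd f \<subseteq> S" unfolding bd_def by auto
  have "\<exists>e\<in>T. ends e \<inter> P \<noteq> {}"
  proof (rule ccontr)
    assume no: "\<not> ?thesis"
    obtain e where e: "e \<in> T" using T by auto
    obtain p q where pq: "ends e = {p, q}" using card_ends[of e] e T(1) bdS by (auto simp: card_2_iff)
    obtain e1 e2 r where t: "T = {e, e1, e2}" "bd f = {e, e1, e2}" "ends e1 = {p, r}" "ends e2 = {q, r}"
      using triangle[OF f(2) T(1,3) e pq] by metis
    have "p \<notin> P" "q \<notin> P" "r \<notin> P" using no t pq by auto
    then show False using bip[of e p q] bip[of e1 p r] bip[of e2 q r] t pq bdS by auto
  qed
  then obtain e x where e: "e \<in> T" "x \<in> ends e" "x \<in> P" by auto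
  obtain i j where ij: "e = arm x i j" using arm(4)[OF e(3) _ e(2)] e(1) T(1) bdS by blast
  let ?q = "tip x i j"
  obtain e1 e2 r where t: "bd f = {e, e1, e2}" "ends e1 = {x, r}" "ends e2 = {?q, r}"
    "r \<noteq> x" "r \<noteq> ?q" "x \<noteq> ?q" "e1 \<noteq> e" "e2 \<noteq> e" "e1 \<noteq> e2"
    using triangle[OF f(2) T(1,3) e(1), of x ?q] arm(2)[OF e(3)] ij by metis
  obtain k l where kl: "e1 = arm x k l" using arm(4)[OF e(3), of e1] t bdS by blast
  have r: "r = tip x k l" using t(2,4) arm(2)[OF e(3), of k l] kl by (metis doubleton_eq_iff)
  have x2: "x \<notin> ends e2" using t by auto
  have notP: "?q \<notin> P" "r \<notin> P" using arm(3) e(3) r by auto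
  then have "col ?q \<noteq> col r" using bip[of e2 ?q r] t bdS by auto
  then have ik: "i \<noteq> k" using tip_col[OF e(3)] r by auto
  have arms: "(a = i \<and> b = j) \<or> (a = k \<and> b = l)" if "arm x a b \<in> bd f" for a b
  proof -
    have "arm x a b \<noteq> e2" using x2 arm(2)[OF e(3), of a b] by auto
    then show ?thesis using that t(1) ij kl by (simp add: arm_eq_iff e(3))
  qed
  \<comment> \<open>Otherwise the other arm with index \<open>i\<close> would border
    \<open>f\<close> too, but the only second arm of \<open>x\<close> there has index
    \<open>k\<close>.\<close>
  have "f \<noteq> mono x i"
    using arms[of i "\<not> j"] ik arm_in_bd[OF e(3) f(1), of i "\<not> j"] by auto
  moreover have "f = mono x i \<or> f = alt x j"
    using arm_in_bd[OF e(3) f(1), of i j] ij t(1) by auto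
  ultimately have "(x, j) \<in> alts f" using e(3) unfolding alts_def by auto
  then show "alts f \<noteq> {}" by auto
  show "monos f = {}"
  proof (rule ccontr)
    assume "monos f \<noteq> {}"
    then obtain y m where y: "y \<in> P" "mono y m = f" unfolding monos_def by auto
    then have in_bd: "arm y m b \<in> bd f" for b using arm_in_bd[OF y(1) f(1)] by auto
    then have "y \<in> ends e \<union> ends e1 \<union> ends e2" 
      using t(1) arm(2)[OF y(1), of m True] in_bd[of True] by (metis UnCI insertE insertI1 empty_iff)
    then have "y = x" using t arm(2)[OF e(3), of i j] ij notP y(1) by auto
    then show False using arms[of m True] arms[of m False] in_bd[of True] in_bd[of False] ik by auto
  qed
qed

text \<open>If \<open>T\<close> contained an arm of \<open>x\<close>, it would contain both, and
  each tip would have to be met again by an arm of \<open>y\<close>. By \<open>nic\<close> the two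
  tips of \<open>x\<close> then coincide, so the two arms would have the same ends.\<close>

lemma no_cycle_at_two_mono_sectors:
  assumes xy: "x \<in> P" "y \<in> P" "x \<noteq> y" and T: "T \<subseteq> {arm x a b | b. True} \<union> {arm y c d | d. True}"
    "\<And>e p. e \<in> T \<Longrightarrow> p \<in> ends e \<Longrightarrow> \<exists>e'\<in>T. e' \<noteq> e \<and> p \<in> ends e'"
  shows "arm x a b \<notin> T"
proof
  assume b: "arm x a b \<in> T"
  have other: "\<exists>d. tip x a b = tip y c d" if b: "arm x a b \<in> T" for b
  proof -
    obtain e' where e': "e' \<in> T" "e' \<noteq> arm x a b" "tip x a b \<in> ends e'"
      using T(2)[OF b, of "tip x a b"] arm(2)[OF xy(1), of a b] by auto
    have "e' \<noteq> arm x a b'" for b'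
    proof
      assume eq: "e' = arm x a b'"
      then have "tip x a b = tip x a b'"
        using e'(3) arm(2)[OF xy(1), of a b'] arm(3)[OF xy(1), of a b] xy(1) by auto
      then have "ends e' = ends (arm x a b)" using arm(2)[OF xy(1)] eq by simp
      then show False using e'(2) eq ends_inj arm(1)[OF xy(1)] by (metis inj_onD)
    qed
    then obtain d where "e' = arm y c d" using T(1) e'(1) by blast
    then show ?thesis
      using e'(3) arm(2)[OF xy(2), of c d] arm(3)[OF xy(1), of a b] xy(2) by auto
  qed
  obtain e' where e': "e' \<in> T" "e' \<noteq> arm x a b" "x \<in> ends e'"
    using T(2)[OF b, of x] arm(2)[OF xy(1), of a b] by auto
  have "e' \<noteq> arm y c d" for d
    using e'(3) arm(2)[OF xy(2), of c d] arm(3)[OF xy(2), of c d] xy by auto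
  then obtain b' where b': "e' = arm x a b'" using T(1) e'(1) by blast
  obtain d where "tip x a b = tip y c d" using other[OF b] by blast
  moreover obtain d' where "tip x a b' = tip y c d'" using other e'(1) b' by blast
  ultimately have "tip x a b = tip x a b'" using nic[OF xy] by blast
  then have "ends e' = ends (arm x a b)" using arm(2)[OF xy(1)] b' by simp
  then show False using e'(2) b' ends_inj arm(1)[OF xy(1)] by (metis inj_onD)
qed

text \<open>Two monochromatic sectors use four arms, which is the whole boundary. At a single
  crossing these form a star and leave no cycle; at two crossings the preceding lemma applies from
  either side.\<close>

lemma face_degree_4:
  assumes f: "f \<in> \<Phi>" "card (bd f) \<le> 4"
  shows "card (monos f) \<le> 1"
proof (rule ccontr)
  assume "\<not> ?thesis"
  then have "\<not> (\<forall>z\<in>monos f. \<forall>w\<in>monos f. z = w)"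
    using card_le_Suc0_iff_eq[OF finite_sectors(1), of f] by auto
  then obtain x i y k where m: "(x, i) \<in> monos f" "(y, k) \<in> monos f" "(x, i) \<noteq> (y, k)" by auto
  then have xy: "x \<in> P" "y \<in> P" "mono x i = f" "mono y k = f" unfolding monos_def by auto
  obtain T where T: "T \<subseteq> bd f" "T \<noteq> {}"
    "\<And>e p. e \<in> T \<Longrightarrow> p \<in> ends e \<Longrightarrow> \<exists>e'\<in>T. e' \<noteq> e \<and> p \<in> ends e'"
    using cycle[OF f(1)] unfolding bd_def by blast
  let ?A = "{arm x i False, arm x i True, arm y k False, arm y k True}"
  have "?A \<subseteq> bd f" using xy arm_in_bd f(1) by auto
  moreover have "card ?A = 4"
    using m(3) xy(1,2) by (auto simp: card_insert_if arm_eq_iff)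
  ultimately have A: "?A = bd f" using card_seteq[OF finite_bd, of ?A f] f(2) by auto
  have bd: "bd f = {arm x i b | b. True} \<union> {arm y k b | b. True}"
    unfolding A[symmetric] by (auto simp: ex_bool_eq)
  show False
  proof (cases "x = y")
    case True
    obtain e where e: "e \<in> T" using T by auto
    then obtain a b where ab: "e = arm x a b" using bd T(1) True by auto
    obtain e' where e': "e' \<in> T" "e' \<noteq> e" "tip x a b \<in> ends e'"
      using T(3)[OF e, of "tip x a b"] arm(2)[OF xy(1)] ab by auto
    obtain c d where cd: "e' = arm x c d" using bd T(1) e'(1) True by auto
    have "tip x a b \<noteq> x" using arm(3)[OF xy(1)] xy(1) by metis
    then have "e' = e" using same_ends[of e' e x "tip x a b"] e' cd ab arm(1,2)[OF xy(1)] by auto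
    then show False using e' by simp
  next
    case False
    obtain e where e: "e \<in> T" using T by auto
    have 1: "arm x i b \<notin> T" for b
      using no_cycle_at_two_mono_sectors[OF xy(1,2) False, of T i k] T(1,3) bd by auto
    have 2: "arm y k b \<notin> T" for b
      using no_cycle_at_two_mono_sectors[OF xy(2,1) False[symmetric], of T k i] T(1,3) bd by auto
    show False using 1 2 e T(1) bd by auto
  qed
qed

text \<open>There are at most as many boundary arcs as sides. Degree 3 thus means exactly three arcs
  and degree 4 at most four; from degree 5 on, \<open>4 s \<le> 2 d\<close> and
  \<open>20 \<le> 4 d\<close> suffice.\<close>

lemma face_inequality:
  assumes f: "f \<in> \<Phi>"
  shows "20 + 4 * card (monos f) \<le> 6 * face_deg f + 2 * card (alts f)"
proof -
  note le = card_bd_le_face_deg[of f] two_monos_le_card_bd[OF f] face_cycle_card[OF f]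
  consider "face_deg f = 3" | "face_deg f = 4" | "5 \<le> face_deg f" using le by linarith
  then show ?thesis
  proof cases
    case 1
    then have "card (bd f) = 3" using le by simp
    then have "monos f = {}" "card (alts f) \<noteq> 0"
      using face_degree_3[OF f] finite_sectors by auto
    then show ?thesis using 1 by simp
  next
    case 2
    then have "card (monos f) \<le> 1" using face_degree_4[OF f] le by simp
    then show ?thesis using 2 by simp
  next
    case 3 then show ?thesis using le by linarith
  qed
qed

theorem face_count: "5 * card \<Phi> + card P \<le> 3 * card S"
proof -
  have "(\<Sum>f\<in>\<Phi>. 20 + 4 * card (monos f)) \<le> (\<Sum>f\<in>\<Phi>. 6 * face_deg f + 2 * card (alts f))"
    using face_inequality by (rule sum_mono)
  then have "20 * card \<Phi> + 4 * (\<Sum>f\<in>\<Phi>. card (monos f)) \<le> 6 * (\<Sum>f\<in>\<Phi>. face_deg f) + 2 * (\<Sum>f\<in>\<Phi>. card (alts f))"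
    by (simp add: sum.distrib flip: sum_distrib_left)
  moreover have "(\<Sum>f\<in>\<Phi>. card (monos f)) = 2 * card P" "(\<Sum>f\<in>\<Phi>. card (alts f)) = 2 * card P"
    unfolding monos_def alts_def using sum_sectors face_in by auto
  ultimately show ?thesis using sum_face_deg by linarith
qed

end

subsection \<open>Planarisation of a NIC-planar drawing\<close>

lemma crosses_at_mem:
  assumes "crosses_at A B p" shows "p \<in> A"
proof -
  obtain U h k where "open U" and U: "p \<in> U" "homeomorphism U (ball 0 1) h k" "h p = 0"
    "h ` (U \<inter> A) = {z \<in> ball 0 1. Im z = 0}" and "h ` (U \<inter> B) = {z \<in> ball 0 1. Re z = 0}"
    using assms unfolding crosses_at_def by (elim exE conjE) (rule that)
  have "h p \<in> h ` (U \<inter> A)" unfolding U(4) U(3) by simp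
  then obtain u where u: "u \<in> U" "u \<in> A" "h u = h p" by auto
  have "k (h u) = u" "k (h p) = p" using U(1,2) u(1) unfolding homeomorphism_def by auto
  then have "u = p" unfolding u(3) by metis
  then show ?thesis using u(2) by simp
qed

locale bipartite_nic_drawing =
  fixes V X Y :: "'a set" and E :: "'a set set" and \<pi> :: "'a \<Rightarrow> complex" and \<gamma> :: "'a set \<Rightarrow> real \<Rightarrow> complex"
  assumes graph: "simple_graph V E" and XV: "X \<subseteq> V" and XY: "X \<inter> Y = {}" "\<And>e. e \<in> E \<Longrightarrow> \<exists>a\<in>X. \<exists>b\<in>Y. e = {a, b}"
    and drawing: "nic_drawing V E \<pi> \<gamma>"
begin

abbreviation "im e \<equiv> path_image (\<gamma> e)"
abbreviation "cross \<equiv> edges_cross_at \<gamma>"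

lemma topological: "topological_drawing V E \<pi> \<gamma>" using drawing unfolding nic_drawing_def by simp

lemma placement_inj: "inj_on \<pi> V" using topological unfolding topological_drawing_def by simp

lemma arc_edge: "e \<in> E \<Longrightarrow> arc (\<gamma> e)" "e \<in> E \<Longrightarrow> {pathstart (\<gamma> e), pathfinish (\<gamma> e)} = \<pi> ` e"
  using topological unfolding topological_drawing_def by simp_all

lemma vertex_on_edge: "e \<in> E \<Longrightarrow> v \<in> V \<Longrightarrow> \<pi> v \<in> im e \<Longrightarrow> v \<in> e"
  using topological unfolding topological_drawing_def by simp

lemma adjacent_no_cross: "e \<in> E \<Longrightarrow> f \<in> E \<Longrightarrow> cross e f p \<Longrightarrow> e \<inter> f = {}"
  using topological unfolding topological_drawing_def by meson

lemma common_point: "e \<in> E \<Longrightarrow> f \<in> E \<Longrightarrow> e \<noteq> f \<Longrightarrow> p \<in> im e \<Longrightarrow> p \<in> im f \<Longrightarrow>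
   p \<in> \<pi> ` (e \<inter> f) \<or> cross e f p"
  using topological unfolding topological_drawing_def by (meson IntI)

lemma cross_unique: "e \<in> E \<Longrightarrow> f \<in> E \<Longrightarrow> g \<in> E \<Longrightarrow> cross e f p \<Longrightarrow> cross e g q \<Longrightarrow> f = g \<and> p = q"
  using drawing unfolding nic_drawing_def by meson

lemma cross_pairs: "e \<in> E \<Longrightarrow> f \<in> E \<Longrightarrow> e' \<in> E \<Longrightarrow> f' \<in> E \<Longrightarrow> cross e f p \<Longrightarrow> cross e' f' q \<Longrightarrow>
   {e, f} \<noteq> {e', f'} \<Longrightarrow> card ((e \<union> f) \<inter> (e' \<union> f')) < 2"
  using drawing unfolding nic_drawing_def by meson

lemma cross_sym: "cross e f p \<Longrightarrow> cross f e p"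
  unfolding edges_cross_at_def using crosses_at_sym by blast

lemma cross_mem: "cross e f p \<Longrightarrow> p \<in> im e"
  unfolding edges_cross_at_def using crosses_at_mem by blast

lemma finite_V: "finite V" and edge_sub: "e \<in> E \<Longrightarrow> e \<subseteq> V"
  using graph unfolding simple_graph_def by auto

lemma finite_edge: "e \<in> E \<Longrightarrow> finite e"
  using edge_sub finite_V finite_subset by metis

lemma finite_E: "finite E"
  using finite_subset[of E "Pow V"] finite_V edge_sub by blast

lemma edge_pair:
  assumes "e \<in> E" obtains a b where "e = {a, b}" "a \<noteq> b" "a \<in> X" "b \<in> Y" "b \<notin> X"
  using XY(2)[OF assms] XY(1) by blast

text \<open>
  Planarisation: the crossing points become vertices and a crossed edge \<open>e = {v, w}\<close> is cut into
  \<open>piece e v\<close> and \<open>piece e w\<close>; if \<open>e\<close> is uncrossed, both of these are the whole arc of \<open>e\<close>.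
\<close>

definition "P = {p. \<exists>e\<in>E. \<exists>f\<in>E. cross e f p}"
definition "W = \<pi> ` V \<union> P"

lemma crossing_edges:
  assumes "p \<in> P" obtains e f where "e \<in> E" "f \<in> E" "cross e f p"
  using assms unfolding P_def by blast

text \<open>In the last claim, a third edge through \<open>p\<close> would have to cross
  \<open>e\<close> there, as \<open>p\<close> is no vertex; but \<open>e\<close> has only one
  crossing.\<close>

lemma crossD:
  assumes "e \<in> E" "f \<in> E" "cross e f p"
  shows "e \<noteq> f" "p \<in> im e" "p \<in> im f" "e \<inter> f = {}" "p \<notin> \<pi> ` V" "{g \<in> E. p \<in> im g} = {e, f}"
proof -
  show ne: "e \<noteq> f" using assms(3) unfolding edges_cross_at_def by simp
  show mem: "p \<in> im e" "p \<in> im f" using cross_mem assms(3) cross_sym by blast+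
  show dis: "e \<inter> f = {}" using adjacent_no_cross assms by blast
  show nv: "p \<notin> \<pi> ` V"
  proof
    assume "p \<in> \<pi> ` V"
    then obtain v where "v \<in> V" "p = \<pi> v" by blast
    then have "v \<in> e \<inter> f" using vertex_on_edge assms mem by blast
    then show False using dis by blast
  qed
  have "g = f" if g: "g \<in> E" "p \<in> im g" "g \<noteq> e" for g
  proof -
    have "p \<in> \<pi> ` (e \<inter> g) \<or> cross e g p" using common_point[OF assms(1) g(1)] g mem by blast
    moreover have "p \<notin> \<pi> ` (e \<inter> g)" using nv edge_sub[OF g(1)] by blast
    ultimately show ?thesis using cross_unique[OF assms(1,2) g(1) assms(3)] by blast
  qed
  then show "{g \<in> E. p \<in> im g} = {e, f}" using assms mem by blast
qed

lemma P_vertex: "P \<inter> \<pi> ` V = {}"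
  using crossD(5) unfolding P_def by blast

lemma crossing_unique:
  assumes "e \<in> E" "p \<in> P" "p \<in> im e" "q \<in> P" "q \<in> im e" shows "p = q"
proof -
  have "\<exists>f\<in>E. cross e f r" if r: "r \<in> P" "r \<in> im e" for r
  proof -
    obtain e' f' where ef: "e' \<in> E" "f' \<in> E" "cross e' f' r"
      using crossing_edges[OF r(1)] .
    have "e \<in> {e', f'}" unfolding crossD(6)[OF ef, symmetric] using assms(1) r(2) by simp
    then show ?thesis using ef cross_sym by blast
  qed
  then obtain f g where "f \<in> E" "g \<in> E" "cross e f p" "cross e g q" using assms by meson
  then show ?thesis using cross_unique[OF assms(1)] by meson
qed

lemma finite_P: "finite P"
proof -
  have "finite (P \<inter> im e)" if "e \<in> E" for e
  proof (cases "P \<inter> im e = {}")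
    case False
    then obtain p where "p \<in> P" "p \<in> im e" by blast
    then have "P \<inter> im e \<subseteq> {p}" using crossing_unique[OF that] by blast
    then show ?thesis by (rule finite_subset) simp
  qed simp
  then have "finite (\<Union>e\<in>E. P \<inter> im e)" using finite_E by blast
  moreover have "P \<subseteq> (\<Union>e\<in>E. P \<inter> im e)"
  proof
    fix p assume p: "p \<in> P"
    then obtain e f where "e \<in> E" "cross e f p" unfolding P_def by blast
    then show "p \<in> (\<Union>e\<in>E. P \<inter> im e)" using p cross_mem by blast
  qed
  ultimately show ?thesis by (rule rev_finite_subset)
qed

lemma edge_Int_W: "e \<in> E \<Longrightarrow> im e \<inter> W = \<pi> ` e \<union> (P \<inter> im e)"
proof -
  assume e: "e \<in> E"
  have "\<pi> ` e \<subseteq> im e" 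
    unfolding arc_edge(2)[OF e, symmetric] by (simp add: pathstart_in_path_image pathfinish_in_path_image)
  moreover have "im e \<inter> \<pi> ` V \<subseteq> \<pi> ` e" using vertex_on_edge[OF e] by blast
  ultimately show ?thesis using edge_sub[OF e] unfolding W_def by blast
qed

lemma edges_Int: "e \<in> E \<Longrightarrow> f \<in> E \<Longrightarrow> e \<noteq> f \<Longrightarrow> im e \<inter> im f \<subseteq> W"
  using common_point edge_sub unfolding W_def P_def by blast

section \<open>Cutting crossed edges into pieces\<close>

text \<open>Pieces are indexed by the end they contain, not by the direction of
  \<open>\<gamma> e\<close>. An edge has at most one crossing point, so quantifying over
  \<open>x\<close> covers the crossed case without naming it.\<close>

definition pieces :: "'a set \<Rightarrow> ('a \<Rightarrow> complex set) \<Rightarrow> bool" where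
  "pieces e c \<longleftrightarrow> (\<forall>v\<in>e. \<exists>g. arc g \<and> path_image g = c v \<and> c v \<inter> W = {pathstart g, pathfinish g}) \<and>
     (\<forall>v\<in>e. c v \<subseteq> im e) \<and>
     (P \<inter> im e = {} \<longrightarrow> (\<forall>v\<in>e. c v = im e \<and> c v \<inter> W = \<pi> ` e)) \<and>
     (\<forall>x\<in>P \<inter> im e. \<Union>(c ` e) = im e \<and> (\<forall>v\<in>e. c v \<inter> W = {\<pi> v, x} \<and> (\<forall>w\<in>e. v \<noteq> w \<longrightarrow> c v \<inter> c w = {x})))"

lemma pieces_exist:
  assumes e: "e \<in> E" shows "\<exists>c. pieces e c"
proof (cases "P \<inter> im e = {}")
  case True
  then have "im e \<inter> W = \<pi> ` e" using edge_Int_W[OF e] by simp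
  then have "pieces e (\<lambda>v. im e)"
    unfolding pieces_def using arc_edge[OF e] True by auto
  then show ?thesis by blast
next
  case False
  then obtain x where x: "x \<in> P" "x \<in> im e" by blast
  have only: "P \<inter> im e = {x}" using crossing_unique[OF e] x by blast
  have xv: "x \<notin> \<pi> ` V" using P_vertex x by blast
  have se: "pathstart (\<gamma> e) \<in> \<pi> ` e" "pathfinish (\<gamma> e) \<in> \<pi> ` e" using arc_edge(2)[OF e] by blast+
  obtain a b where ab: "e = {a, b}" "a \<noteq> b" "pathstart (\<gamma> e) = \<pi> a" "pathfinish (\<gamma> e) = \<pi> b"
  proof -
    obtain a b where 1: "e = {a, b}" "a \<noteq> b" using edge_pair[OF e] by metis
    then have "{pathstart (\<gamma> e), pathfinish (\<gamma> e)} = {\<pi> a, \<pi> b}" using arc_edge(2)[OF e] by simp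
    then consider "pathstart (\<gamma> e) = \<pi> a" "pathfinish (\<gamma> e) = \<pi> b" | "pathstart (\<gamma> e) = \<pi> b" "pathfinish (\<gamma> e) = \<pi> a"
      by (auto simp: doubleton_eq_iff)
    then show thesis
      by cases (use that[of a b] that[of b a] 1 in \<open>auto simp: insert_commute\<close>)
  qed
  have abV: "a \<in> V" "b \<in> V" using edge_sub[OF e] ab by auto
  have pab: "\<pi> a \<noteq> \<pi> b" using placement_inj ab(2) abV by (meson inj_onD)
  have xab: "x \<noteq> \<pi> a" "x \<noteq> \<pi> b" using xv abV by blast+
  obtain g1 g2 where g: "arc g1" "arc g2" "pathstart g1 = \<pi> a" "pathfinish g1 = x"
    "pathstart g2 = x" "pathfinish g2 = \<pi> b"
    "path_image g1 \<union> path_image g2 = im e" "path_image g1 \<inter> path_image g2 = {x}"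
    using split_arc[OF arc_edge(1)[OF e] x(2)] xab ab(3,4) by metis
  have imW: "im e \<inter> W = {\<pi> a, \<pi> b, x}" using edge_Int_W[OF e] only ab(1) by auto
  have pa: "\<pi> a \<in> path_image g1" "\<pi> b \<in> path_image g2" "x \<in> path_image g1" "x \<in> path_image g2"
    using g by (metis pathstart_in_path_image pathfinish_in_path_image)+
  then have "\<pi> a \<notin> path_image g2" "\<pi> b \<notin> path_image g1"
    using g(8) xab by (metis IntI singletonD)+
  moreover have "path_image g1 \<inter> W = path_image g1 \<inter> {\<pi> a, \<pi> b, x}"
    "path_image g2 \<inter> W = path_image g2 \<inter> {\<pi> a, \<pi> b, x}"
    unfolding imW[symmetric] g(7)[symmetric] by blast+
  ultimately have W: "path_image g1 \<inter> W = {\<pi> a, x}" "path_image g2 \<inter> W = {\<pi> b, x}"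
    using pa by simp_all
  define c where "c v = (if v = a then path_image g1 else path_image g2)" for v
  have c: "c a = path_image g1" "c b = path_image g2" using ab(2) unfolding c_def by auto
  have "\<exists>g. arc g \<and> path_image g = c a \<and> c a \<inter> W = {pathstart g, pathfinish g}"
    using g W c by (intro exI[of _ g1]) simp
  moreover have "\<exists>g. arc g \<and> path_image g = c b \<and> c b \<inter> W = {pathstart g, pathfinish g}"
    using g W c by (intro exI[of _ g2]) (simp add: insert_commute)
  moreover have ve: "v = a \<or> v = b" if "v \<in> e" for v using that ab(1) by blast
  ultimately have "\<forall>v\<in>e. \<exists>g. arc g \<and> path_image g = c v \<and> c v \<inter> W = {pathstart g, pathfinish g}"
    by metis
  moreover have "\<forall>v\<in>e. c v \<subseteq> im e" using ve c g(7) by blast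
  moreover have "\<Union>(c ` e) = im e" using ab(1) c g(7) by (simp only: image_insert image_empty Union_insert Union_empty Un_empty_right)
  moreover have "\<forall>v\<in>e. c v \<inter> W = {\<pi> v, x}" using ve c W by metis
  moreover have "\<forall>v\<in>e. \<forall>w\<in>e. v \<noteq> w \<longrightarrow> c v \<inter> c w = {x}" using ve c g(8) Int_commute by metis
  ultimately have "pieces e c" unfolding pieces_def only by simp
  then show ?thesis by blast
qed

definition "piece e = (SOME c. pieces e c)"
definition "S = (\<Union>e\<in>E. piece e ` e)"

lemma piece: "e \<in> E \<Longrightarrow> pieces e (piece e)"
  unfolding piece_def using pieces_exist someI_ex by metis

lemma piece_arc: "e \<in> E \<Longrightarrow> v \<in> e \<Longrightarrow> \<exists>g. arc g \<and> path_image g = piece e v \<and> piece e v \<inter> W = {pathstart g, pathfinish g}"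
  using piece unfolding pieces_def by simp

lemma piece_sub: "e \<in> E \<Longrightarrow> v \<in> e \<Longrightarrow> piece e v \<subseteq> im e"
  using piece unfolding pieces_def by simp

lemma piece_uncrossed: "e \<in> E \<Longrightarrow> v \<in> e \<Longrightarrow> P \<inter> im e = {} \<Longrightarrow> piece e v = im e \<and> piece e v \<inter> W = \<pi> ` e"
  using piece unfolding pieces_def by meson

lemma piece_crossed:
  assumes "e \<in> E" "x \<in> P" "x \<in> im e"
  shows "\<Union>(piece e ` e) = im e" "v \<in> e \<Longrightarrow> piece e v \<inter> W = {\<pi> v, x}"
    "v \<in> e \<Longrightarrow> w \<in> e \<Longrightarrow> v \<noteq> w \<Longrightarrow> piece e v \<inter> piece e w = {x}"
  using piece[OF assms(1)] assms(2,3) unfolding pieces_def by simp_all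

lemma S_cases: "A \<in> S \<Longrightarrow> \<exists>e\<in>E. \<exists>v\<in>e. A = piece e v"
  unfolding S_def by blast

lemma piece_S: "e \<in> E \<Longrightarrow> v \<in> e \<Longrightarrow> piece e v \<in> S" unfolding S_def by blast

lemma piece_Int: 
  assumes "e \<in> E" "f \<in> E" "v \<in> e" "w \<in> f" "piece e v \<noteq> piece f w" shows "piece e v \<inter> piece f w \<subseteq> W"
proof (cases "e = f")
  case False
  then show ?thesis using edges_Int assms piece_sub by blast
next
  case True
  show ?thesis
  proof (cases "P \<inter> im e = {}")
    case True
    then show ?thesis using piece_uncrossed \<open>e = f\<close> assms by metis
  next
    case False
    then obtain x where x: "x \<in> P" "x \<in> im e" by blast
    have "v \<noteq> w" using assms(5) True by auto
    then have "piece e v \<inter> piece e w = {x}" using piece_crossed(3)[OF assms(1) x] assms(3,4) True by blast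
    then show ?thesis using True x(1) unfolding W_def by auto
  qed
qed

lemma plane: "plane_graph W S"
  unfolding plane_graph_def
proof (intro conjI ballI impI)
  show "finite W" using finite_V finite_P unfolding W_def by simp
  show "finite S" using finite_E finite_edge unfolding S_def by simp
  show "\<exists>g. arc g \<and> path_image g = A \<and> A \<inter> W = {pathstart g, pathfinish g}" if "A \<in> S" for A
    using S_cases[OF that] piece_arc by blast
  show "A \<inter> B \<subseteq> W" if "A \<in> S" "B \<in> S" "A \<noteq> B" for A B
    using S_cases[OF that(1)] S_cases[OF that(2)] piece_Int that(3) by blast
qed

lemma piece_not_sub: "e \<in> E \<Longrightarrow> v \<in> e \<Longrightarrow> \<not> piece e v \<subseteq> W"
proof -
  assume e: "e \<in> E" "v \<in> e"
  obtain g where g: "arc g" "path_image g = piece e v" "piece e v \<inter> W = {pathstart g, pathfinish g}"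
    using piece_arc[OF e] by metis
  show ?thesis using arc_minus_ends(2)[OF g(1)] g(2,3) by blast
qed

text \<open>Different edges meet only in \<open>W\<close>, whereas every piece has points outside
  \<open>W\<close>.\<close>

lemma piece_eqD:
  assumes "e \<in> E" "f \<in> E" "v \<in> e" "w \<in> f" "piece e v = piece f w" shows "e = f"
  using edges_Int[OF assms(1,2)] piece_sub[OF assms(1,3)] piece_sub[OF assms(2,4)] piece_not_sub[OF assms(1,3)] assms(5)
  by blast

lemma piece_inj:
  assumes "e \<in> E" "x \<in> P" "x \<in> im e" shows "inj_on (piece e) e"
proof (rule inj_onI, rule ccontr)
  fix v w assume vw: "v \<in> e" "w \<in> e" "piece e v = piece e w" "v \<noteq> w"
  then have "piece e v = {x}" using piece_crossed(3)[OF assms] by blast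
  then show False using piece_not_sub[OF assms(1) vw(1)] assms(2) unfolding W_def by simp
qed

lemma card_edge: "e \<in> E \<Longrightarrow> card e = 2" using graph unfolding simple_graph_def by simp

lemma card_pieces: "e \<in> E \<Longrightarrow> card (piece e ` e) = 1 + card (P \<inter> im e)"
proof (cases "P \<inter> im e = {}")
  case True
  assume e: "e \<in> E"
  have "e \<noteq> {}" using card_edge[OF e] by auto
  then have "piece e ` e = {im e}" using piece_uncrossed[OF e _ True] by auto
  then show ?thesis using True by simp
next
  case False
  assume e: "e \<in> E"
  then obtain x where x: "x \<in> P" "x \<in> im e" using False by blast
  have "P \<inter> im e = {x}" using crossing_unique[OF e] x by blast
  then show ?thesis using card_image[OF piece_inj[OF e x]] card_edge[OF e] by simp
qed

text \<open>A crossing point on an edge yields one extra piece. Each crossing point lies on exactly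
  two edges, so counting incident pairs in both ways gives \<open>2 * card P\<close>.\<close>

lemma card_S: "card S = card E + 2 * card P"
proof -
  have "card S = (\<Sum>e\<in>E. card (piece e ` e))"
    unfolding S_def
  proof (rule card_UN_disjoint[OF finite_E])
    show "\<forall>e\<in>E. finite (piece e ` e)" using finite_edge by simp
    show "\<forall>e\<in>E. \<forall>f\<in>E. e \<noteq> f \<longrightarrow> piece e ` e \<inter> piece f ` f = {}" using piece_eqD by blast
  qed
  also have "\<dots> = card E + (\<Sum>e\<in>E. card (P \<inter> im e))" 
    by (simp only: card_pieces sum.distrib cong: sum.cong) simp
  also have "(\<Sum>e\<in>E. card (P \<inter> im e)) = (\<Sum>e\<in>E. \<Sum>x\<in>P. if x \<in> im e then 1 else 0)"
    using finite_P by (simp add: sum.If_cases)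
  also have "\<dots> = (\<Sum>x\<in>P. \<Sum>e\<in>E. if x \<in> im e then 1 else 0)" by (rule sum.swap)
  also have "\<dots> = (\<Sum>x\<in>P. 2)"
  proof (rule sum.cong[OF refl])
    fix x assume x: "x \<in> P"
    obtain e f where "e \<in> E" "f \<in> E" "cross e f x" using crossing_edges[OF x] .
    then have "e \<noteq> f" "{g \<in> E. x \<in> im g} = {e, f}" by (rule crossD)+
    then have "card {g \<in> E. x \<in> im g} = 2" by simp
    then show "(\<Sum>e\<in>E. if x \<in> im e then 1 else 0) = (2::nat)"
      using finite_E by (simp add: sum.If_cases Int_def)
  qed
  finally show ?thesis by simp
qed

lemma card_W: "card W = card V + card P"
  unfolding W_def using finite_V finite_P P_vertex card_image[OF placement_inj]
  by (subst card_Un_disjoint) (auto simp: Int_commute)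

section \<open>Colours and cyclic order at a crossing\<close>

definition "col p \<longleftrightarrow> p \<in> \<pi> ` X"

lemma col_edge:
  assumes "e \<in> E" "v \<in> e" "w \<in> e" "v \<noteq> w" shows "col (\<pi> v) \<noteq> col (\<pi> w)"
proof -
  obtain a b where ab: "e = {a, b}" "a \<noteq> b" "a \<in> X" "b \<in> Y" "b \<notin> X" using edge_pair[OF assms(1)] by metis
  have "\<pi> b \<notin> \<pi> ` X"
    using inj_on_image_mem_iff[OF placement_inj] ab edge_sub[OF assms(1)] XV by auto
  then show ?thesis using ab assms unfolding col_def by auto
qed

text \<open>Transfers \<open>crossing_sectors\<close> to the drawing: the four ends are named in
  cyclic order around \<open>x\<close>, opposite ends belonging to the same edge.\<close>

lemma crossing_arms:
  assumes x: "x \<in> P"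
  obtains e f v0 v1 v2 v3 a0 a1 a2 a3 g0 g1 g2 g3 where
    "e \<in> E" "f \<in> E" "e = {v0, v2}" "f = {v1, v3}" "distinct [v0, v1, v2, v3]" "cross e f x"
    "a0 = piece e v0" "a1 = piece f v1" "a2 = piece e v2" "a3 = piece f v3"
    "\<And>A. A \<in> S \<Longrightarrow> x \<in> A \<Longrightarrow> A \<in> {a0, a1, a2, a3}"
    "{f \<in> faces W S. incident W a0 f} = {g0, g3}"
    "{f \<in> faces W S. incident W a1 f} = {g1, g0}"
    "{f \<in> faces W S. incident W a2 f} = {g2, g1}"
    "{f \<in> faces W S. incident W a3 f} = {g3, g2}"
proof -
  obtain e f where ef: "e \<in> E" "f \<in> E" "cross e f x" using crossing_edges[OF x] .
  note cD = crossD[OF ef]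
  have xe: "x \<in> im e" "x \<in> im f" by (rule cD)+
  obtain a a' where a: "e = {a, a'}" "a \<noteq> a'" using edge_pair[OF ef(1)] by metis
  obtain b b' where b: "f = {b, b'}" "b \<noteq> b'" using edge_pair[OF ef(2)] by metis
  have un: "piece e a \<union> piece e a' = im e" "piece f b \<union> piece f b' = im f"
    using piece_crossed(1)[OF ef(1) x xe(1)] piece_crossed(1)[OF ef(2) x xe(2)] a b by simp_all
  have it: "piece e a \<inter> piece e a' = {x}" "piece f b \<inter> piece f b' = {x}"
    using piece_crossed(3)[OF ef(1) x xe(1)] piece_crossed(3)[OF ef(2) x xe(2)] a b by simp_all
  have cr: "crosses_at (piece e a \<union> piece e a') (piece f b \<union> piece f b') x"
    using ef(3) unfolding un edges_cross_at_def by simp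
  have only: "A \<in> {piece e a, piece e a', piece f b, piece f b'}" if A: "A \<in> S" "x \<in> A" for A
  proof -
    obtain g v where g: "g \<in> E" "v \<in> g" "A = piece g v" using S_cases[OF A(1)] by blast
    then have "x \<in> im g" using piece_sub A(2) by blast
    then have "g \<in> {e, f}" unfolding cD(6)[symmetric] using g(1) by simp
    then show ?thesis using g a b by auto
  qed
  have pS: "piece e a \<in> S" "piece e a' \<in> S" "piece f b \<in> S" "piece f b' \<in> S"
    using piece_S ef(1,2) a b by auto
  have xW: "x \<in> W" using x unfolding W_def by simp
  obtain a0 a1 a2 a3 g0 g1 g2 g3 where r:
    "a0 = piece e a \<and> a2 = piece e a' \<or> a0 = piece e a' \<and> a2 = piece e a"
    "a1 = piece f b \<and> a3 = piece f b' \<or> a1 = piece f b' \<and> a3 = piece f b"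
    "{f \<in> faces W S. incident W a0 f} = {g0, g3}"
    "{f \<in> faces W S. incident W a1 f} = {g1, g0}"
    "{f \<in> faces W S. incident W a2 f} = {g2, g1}"
    "{f \<in> faces W S. incident W a3 f} = {g3, g2}"
    by (rule crossing_sectors[OF plane xW pS only it cr]) (assumption | rule that)+
  obtain v0 v2 where v02: "e = {v0, v2}" "v0 \<noteq> v2" "a0 = piece e v0" "a2 = piece e v2"
    using r(1) a by (metis insert_commute)
  obtain v1 v3 where v13: "f = {v1, v3}" "v1 \<noteq> v3" "a1 = piece f v1" "a3 = piece f v3"
    using r(2) b by (metis insert_commute)
  have "distinct [v0, v1, v2, v3]" using cD(4) v02(1,2) v13(1,2) by auto
  moreover have "A \<in> {a0, a1, a2, a3}" if "A \<in> S" "x \<in> A" for A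
    using only[OF that] r(1,2) by auto
  ultimately show thesis
    using that[OF ef(1,2) v02(1) v13(1) _ ef(3) v02(3) v13(3) v02(4) v13(4) _ r(3-6)] by blast
qed

text \<open>Bundles what \<open>crossing_map\<close> requires at one crossing, so that labellings
  can be chosen for all crossings at once. The last clause places the tips among the four endpoints
  to which the NIC condition refers.\<close>

definition arrangement ::
  "complex \<Rightarrow> (bool \<Rightarrow> bool \<Rightarrow> complex set) \<Rightarrow> (bool \<Rightarrow> bool \<Rightarrow> complex) \<Rightarrow> (bool \<Rightarrow> complex set) \<Rightarrow> (bool \<Rightarrow> complex set) \<Rightarrow> bool"
  where "arrangement x arm tip mface aface \<longleftrightarrow>
    (\<forall>i j. arm i j \<in> S \<and> arm i j \<inter> W = {x, tip i j} \<and> tip i j \<notin> P) \<and>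
    (\<forall>A\<in>S. x \<in> A \<longrightarrow> (\<exists>i j. A = arm i j)) \<and>
    (\<forall>i j i' j'. arm i j = arm i' j' \<longrightarrow> i = i' \<and> j = j') \<and>
    (\<forall>i j. {f \<in> faces W S. incident W (arm i j) f} = {mface i, aface j}) \<and>
    (\<forall>i j i' j'. col (tip i j) = col (tip i' j') \<longleftrightarrow> i = i') \<and>
    (\<forall>e\<in>E. \<forall>f\<in>E. cross e f x \<longrightarrow> (\<forall>i j. tip i j \<in> \<pi> ` (e \<union> f)))"

lemma arrangementI:
  assumes x: "x \<in> P"
    and vs: "\<And>i j. e i j \<in> E \<and> x \<in> im (e i j) \<and> v i j \<in> e i j \<and> arm i j = piece (e i j) (v i j)"
    and only: "\<And>A. A \<in> S \<Longrightarrow> x \<in> A \<Longrightarrow> \<exists>i j. A = arm i j"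
    and inj_v: "\<And>i j i' j'. v i j = v i' j' \<Longrightarrow> i = i' \<and> j = j'"
    and fc: "\<And>i j. {f \<in> faces W S. incident W (arm i j) f} = {mface i, aface j}"
    and col: "\<And>i j i' j'. col (\<pi> (v i j)) = col (\<pi> (v i' j')) \<longleftrightarrow> i = i'"
  shows "arrangement x arm (\<lambda>i j. \<pi> (v i j)) mface aface"
  unfolding arrangement_def
proof (intro conjI allI ballI impI)
  fix i j
  have v: "e i j \<in> E" "x \<in> im (e i j)" "v i j \<in> e i j" "arm i j = piece (e i j) (v i j)" using vs by blast+
  have vV: "v i j \<in> V" using edge_sub v by blast
  show "arm i j \<in> S" using v piece_S by simp
  show W: "arm i j \<inter> W = {x, \<pi> (v i j)}" using piece_crossed(2)[OF v(1) x v(2,3)] v(4) by auto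
  show "\<pi> (v i j) \<notin> P" using vV P_vertex by blast
  show "{f \<in> faces W S. incident W (arm i j) f} = {mface i, aface j}" by (rule fc)
  show "\<pi> (v i j) \<in> \<pi> ` (d \<union> f)" if d: "d \<in> E" "f \<in> E" "cross d f x" for d f
  proof -
    have "e i j \<in> {d, f}" unfolding crossD(6)[OF d, symmetric] using v by simp
    then show ?thesis using v(3) by blast
  qed
  fix i' j'
  show "col (\<pi> (v i j)) = col (\<pi> (v i' j')) \<longleftrightarrow> i = i'" by (rule col)
  assume eq: "arm i j = arm i' j'"
  have v': "e i' j' \<in> E" "x \<in> im (e i' j')" "v i' j' \<in> e i' j'" "arm i' j' = piece (e i' j') (v i' j')" using vs by blast+
  have "e i j = e i' j'" using piece_eqD[OF v(1) v'(1) v(3) v'(3)] eq v(4) v'(4) by simp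
  then have "v i j = v i' j'" using inj_onD[OF piece_inj[OF v(1) x v(2)]] v v' eq by simp
  then show "i = i'" "j = j'" using inj_v by blast+
next
  show "\<exists>i j. A = arm i j" if "A \<in> S" "x \<in> A" for A using only that .
qed

text \<open>Opposite ends have different colours, so \<open>v0\<close> agrees in colour with exactly
  one of its neighbours \<open>v1\<close> and \<open>v3\<close>. This decides which of the two
  opposite pairs of sectors is monochromatic.\<close>

lemma arrangement_exists:
  assumes x: "x \<in> P"
  shows "\<exists>arm tip mface aface. arrangement x arm tip mface aface"
proof -
  obtain e f v0 v1 v2 v3 a0 a1 a2 a3 g0 g1 g2 g3 where
    ef: "e \<in> E" "f \<in> E" "e = {v0, v2}" "f = {v1, v3}" and dist: "distinct [v0, v1, v2, v3]" and cr: "cross e f x"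
    and a: "a0 = piece e v0" "a1 = piece f v1" "a2 = piece e v2" "a3 = piece f v3"
    and only: "\<And>A. A \<in> S \<Longrightarrow> x \<in> A \<Longrightarrow> A \<in> {a0, a1, a2, a3}"
    and g: "{f \<in> faces W S. incident W a0 f} = {g0, g3}"
    "{f \<in> faces W S. incident W a1 f} = {g1, g0}"
    "{f \<in> faces W S. incident W a2 f} = {g2, g1}"
    "{f \<in> faces W S. incident W a3 f} = {g3, g2}"
    by (rule crossing_arms[OF x]) (assumption | rule that)+
  have xi: "x \<in> im e" "x \<in> im f" using cr cross_mem cross_sym by blast+
  have c02: "col (\<pi> v0) \<noteq> col (\<pi> v2)" using col_edge[OF ef(1), of v0 v2] ef dist by auto
  have c13: "col (\<pi> v1) \<noteq> col (\<pi> v3)" using col_edge[OF ef(2), of v1 v3] ef dist by auto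
  have mem: "v0 \<in> e" "v2 \<in> e" "v1 \<in> f" "v3 \<in> f" using ef(3,4) by simp_all
  show ?thesis
  proof (cases "col (\<pi> v0) = col (\<pi> v1)")
    case True
    \<comment> \<open>The four arguments are put at the indices (False, False), (False, True),
      (True, True), (True, False), which is the cyclic order around the crossing.\<close>
    let ?sel = "\<lambda>p q r s i j. if i then if j then r else s else if j then q else p"
    have "arrangement x (?sel a0 a1 a2 a3) (\<lambda>i j. \<pi> (?sel v0 v1 v2 v3 i j))
       (\<lambda>i. if i then g2 else g0) (\<lambda>j. if j then g1 else g3)"
    proof (rule arrangementI[OF x, where e = "?sel e f e f"])
      show "\<exists>i j. A = ?sel a0 a1 a2 a3 i j" if "A \<in> S" "x \<in> A" for A
        using only[OF that] by (simp add: ex_bool_eq) blast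
      show "?sel e f e f i j \<in> E \<and> x \<in> im (?sel e f e f i j) \<and> ?sel v0 v1 v2 v3 i j \<in> ?sel e f e f i j \<and>
        ?sel a0 a1 a2 a3 i j = piece (?sel e f e f i j) (?sel v0 v1 v2 v3 i j)" for i j
        using ef(1,2) xi mem a by (cases i; cases j) simp_all
      show "i = i' \<and> j = j'" if "?sel v0 v1 v2 v3 i j = ?sel v0 v1 v2 v3 i' j'" for i j i' j'
        using that dist by (cases i; cases j; cases i'; cases j') simp_all
      show "{f \<in> faces W S. incident W (?sel a0 a1 a2 a3 i j) f} = {if i then g2 else g0, if j then g1 else g3}" for i j
        using g by (cases i; cases j) (simp_all add: insert_commute)
      show "col (\<pi> (?sel v0 v1 v2 v3 i j)) = col (\<pi> (?sel v0 v1 v2 v3 i' j')) \<longleftrightarrow> i = i'" for i j i' j'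
        using c02 c13 True by (cases i; cases j; cases i'; cases j') simp_all
    qed
    then show ?thesis by blast
  next
    case False
    \<comment> \<open>Now \<open>v3\<close> and \<open>v0\<close> agree in colour, so the labelling
      is shifted by one and starts at \<open>v3\<close>.\<close>
    let ?sel = "\<lambda>p q r s i j. if i then if j then r else s else if j then q else p"
    have "arrangement x (?sel a3 a0 a1 a2) (\<lambda>i j. \<pi> (?sel v3 v0 v1 v2 i j))
       (\<lambda>i. if i then g1 else g3) (\<lambda>j. if j then g0 else g2)"
    proof (rule arrangementI[OF x, where e = "?sel f e f e"])
      show "\<exists>i j. A = ?sel a3 a0 a1 a2 i j" if "A \<in> S" "x \<in> A" for A
        using only[OF that] by (simp add: ex_bool_eq) blast
      show "?sel f e f e i j \<in> E \<and> x \<in> im (?sel f e f e i j) \<and> ?sel v3 v0 v1 v2 i j \<in> ?sel f e f e i j \<and>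
        ?sel a3 a0 a1 a2 i j = piece (?sel f e f e i j) (?sel v3 v0 v1 v2 i j)" for i j
        using ef(1,2) xi mem a by (cases i; cases j) simp_all
      show "i = i' \<and> j = j'" if "?sel v3 v0 v1 v2 i j = ?sel v3 v0 v1 v2 i' j'" for i j i' j'
        using that dist by (cases i; cases j; cases i'; cases j') simp_all
      show "{f \<in> faces W S. incident W (?sel a3 a0 a1 a2 i j) f} = {if i then g1 else g3, if j then g0 else g2}" for i j
        using g by (cases i; cases j) (simp_all add: insert_commute)
      show "col (\<pi> (?sel v3 v0 v1 v2 i j)) = col (\<pi> (?sel v3 v0 v1 v2 i' j')) \<longleftrightarrow> i = i'" for i j i' j'
        using c02 c13 False by (cases i; cases j; cases i'; cases j') simp_all
    qed
    then show ?thesis by blast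
  qed
qed

section \<open>From the drawing to the edge bound\<close>

text \<open>The second face is what \<open>plane_graph_face_cycle\<close> needs to supply the
  \<open>cycle\<close> assumption.\<close>

lemma face_count:
  assumes two: "2 \<le> card (faces W S)"
  shows "5 * card (faces W S) + card P \<le> 3 * card S"
proof -
  obtain arm tip mface aface where arr: "\<And>x. x \<in> P \<Longrightarrow> arrangement x (arm x) (tip x) (mface x) (aface x)"
    using arrangement_exists by metis
  have A: "arm x i j \<in> S" "arm x i j \<inter> W = {x, tip x i j}" "tip x i j \<notin> P"
    "\<And>A. A \<in> S \<Longrightarrow> x \<in> A \<Longrightarrow> \<exists>i j. A = arm x i j"
    "\<And>i' j'. arm x i j = arm x i' j' \<Longrightarrow> i = i' \<and> j = j'"
    "{f \<in> faces W S. incident W (arm x i j) f} = {mface x i, aface x j}"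
    "\<And>i' j'. col (tip x i j) = col (tip x i' j') \<longleftrightarrow> i = i'"
    "\<And>e f. e \<in> E \<Longrightarrow> f \<in> E \<Longrightarrow> cross e f x \<Longrightarrow> tip x i j \<in> \<pi> ` (e \<union> f)"
    if "x \<in> P" for x i j
    using arr[OF that] unfolding arrangement_def by (simp_all)
  interpret crossing_map S P "faces W S" "\<lambda>A. A \<inter> W" "incident W" col arm tip mface aface
  proof
    show "finite S" "finite P" using plane_graph_finite[OF plane] finite_P by auto
    show "finite (faces W S)" using two card.infinite by fastforce
    show "card (A \<inter> W) = 2" if "A \<in> S" for A
      using plane_graph_arc[OF plane that] arc_distinct_ends by (metis card_2_iff)
    show "inj_on (\<lambda>A. A \<inter> W) S"
    \<comment> \<open>Uncrossed edges are determined by their ends. Pieces sharing a crossing and a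
      vertex belong to the same edge because adjacent edges do not cross.\<close>
    proof (rule inj_onI)
      fix A B assume AB: "A \<in> S" "B \<in> S" "A \<inter> W = B \<inter> W"
      obtain e v where e: "e \<in> E" "v \<in> e" "A = piece e v" using S_cases[OF AB(1)] by blast
      obtain f w where f: "f \<in> E" "w \<in> f" "B = piece f w" using S_cases[OF AB(2)] by blast
      have inVP: "\<pi> u \<notin> P" if "u \<in> V" for u using that P_vertex by blast
      have V: "e \<subseteq> V" "f \<subseteq> V" "v \<in> V" "w \<in> V" using edge_sub e f by auto
      show "A = B"
      proof (cases "P \<inter> im e = {}")
        case True
        then have 1: "A = im e" "A \<inter> W = \<pi> ` e" using piece_uncrossed[OF e(1,2)] e(3) by metis+
        have "P \<inter> im f = {}"
        proof (rule ccontr)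
          assume "P \<inter> im f \<noteq> {}"
          then obtain x where "x \<in> P" "x \<in> im f" by blast
          then have "x \<in> \<pi> ` e" using 1 AB(3) piece_crossed(2)[OF f(1) _ _ f(2)] f(3) by auto
          then show False using inVP V \<open>x \<in> P\<close> by blast
        qed
        then have "B = im f" "B \<inter> W = \<pi> ` f" using piece_uncrossed[OF f(1,2)] f(3) by metis+
        then have "e = f" using 1 AB(3) inj_on_image_eq_iff[OF placement_inj V(1,2)] by simp
        then show ?thesis using 1 \<open>B = im f\<close> by simp
      next
        case False
        then obtain x where x: "x \<in> P" "x \<in> im e" by blast
        then have 1: "A \<inter> W = {\<pi> v, x}" using piece_crossed(2)[OF e(1) x e(2)] e(3) by simp
        then have "x \<in> B" using AB(3) by blast
        then have xf: "x \<in> im f" using piece_sub f by blast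
        then have "B \<inter> W = {\<pi> w, x}" using piece_crossed(2)[OF f(1) x(1) xf f(2)] f(3) by simp
        then have "\<pi> v = \<pi> w" using 1 AB(3) inVP V x(1) by (metis doubleton_eq_iff)
        then have vw: "v = w" using placement_inj V by (meson inj_onD)
        have "e = f"
        proof (rule ccontr)
          assume "e \<noteq> f"
          moreover have "x \<notin> \<pi> ` (e \<inter> f)" using inVP V(1) x(1) by blast
          ultimately have "cross e f x" using common_point[OF e(1) f(1) _ x(2) xf] by blast
          then show False using adjacent_no_cross[OF e(1) f(1)] e(2) f(2) vw by blast
        qed
        then show ?thesis using vw e(3) f(3) by simp
      qed
    qed
    show "col p \<noteq> col q" if A: "A \<in> S" "A \<inter> W = {p, q}" "p \<notin> P" "q \<notin> P" for A p q
    proof -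
      obtain e v where e: "e \<in> E" "v \<in> e" "A = piece e v" using S_cases[OF A(1)] by blast
      have unc: "P \<inter> im e = {}"
      proof (rule ccontr)
        assume "P \<inter> im e \<noteq> {}"
        then obtain x where x: "x \<in> P" "x \<in> im e" by blast
        then have "x \<in> {p, q}" using piece_crossed(2)[OF e(1) x e(2)] e(3) A(2) by auto
        then show False using A(3,4) x(1) by auto
      qed
      have pq: "\<pi> ` e = {p, q}" using piece_uncrossed[OF e(1,2) unc] e(3) A(2) by metis
      obtain a b where ab: "e = {a, b}" "a \<noteq> b" using edge_pair[OF e(1)] by metis
      have "col (\<pi> a) \<noteq> col (\<pi> b)" using col_edge[OF e(1), of a b] ab by auto
      moreover have "p = \<pi> a \<and> q = \<pi> b \<or> p = \<pi> b \<and> q = \<pi> a"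
        using pq unfolding ab(1) by (auto simp: doubleton_eq_iff)
      ultimately show ?thesis by auto
    qed
    show "\<exists>f1 f2. {f \<in> faces W S. incident W A f} = {f1, f2}" if "A \<in> S" for A
      using plane_graph_incident_faces[OF plane that] by metis
    show "\<exists>T\<subseteq>{e \<in> S. incident W e f}. T \<noteq> {} \<and> (\<forall>e\<in>T. \<forall>p\<in>e \<inter> W. \<exists>e'\<in>T. e' \<noteq> e \<and> p \<in> e' \<inter> W)"
      if f: "f \<in> faces W S" for f
    proof -
      have "faces W S \<noteq> {f}" using two by auto
      then obtain f' where f': "f' \<in> faces W S" "f' \<noteq> f" using f by blast
      show ?thesis
      proof (rule plane_graph_face_cycle[OF plane f f'])
        fix T assume T: "T \<subseteq> {A \<in> S. incident W A f}" "T \<noteq> {}"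
          "\<And>A p. A \<in> T \<Longrightarrow> p \<in> A \<inter> W \<Longrightarrow> \<exists>B\<in>T. B \<noteq> A \<and> p \<in> B"
        then show ?thesis by (intro exI[of _ T]) simp
      qed
    qed
    show "tip x i j = tip x i' j'"
      if xy: "x \<in> P" "y \<in> P" "x \<noteq> y" "tip x i j = tip y k l" "tip x i' j' = tip y k' l'" for x y i j k l i' j' k' l'
    proof -
      obtain e f where ef: "e \<in> E" "f \<in> E" "cross e f x" using crossing_edges[OF xy(1)] .
      obtain e' f' where ef': "e' \<in> E" "f' \<in> E" "cross e' f' y" using crossing_edges[OF xy(2)] .
      \<comment> \<open>The same two edges cannot cross at two different points, so different
        crossings come from different pairs.\<close>
      have ne: "{e, f} \<noteq> {e', f'}"
      proof
        assume "{e, f} = {e', f'}"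
        then have "cross e f y" using ef'(3) cross_sym by (auto simp: doubleton_eq_iff)
        then show False using cross_unique[OF ef(1,2,2) ef(3)] xy(3) by blast
      qed
      have c: "card ((e \<union> f) \<inter> (e' \<union> f')) < 2"
        using cross_pairs[OF ef(1,2) ef'(1,2) ef(3) ef'(3) ne] .
      have sub: "e \<union> f \<subseteq> V" "e' \<union> f' \<subseteq> V" using edge_sub ef ef' by auto
      have fin: "finite ((e \<union> f) \<inter> (e' \<union> f'))" using sub finite_V by (meson finite_Int finite_subset)
      have "tip x i j \<in> \<pi> ` (e \<union> f) \<inter> \<pi> ` (e' \<union> f')" "tip x i' j' \<in> \<pi> ` (e \<union> f) \<inter> \<pi> ` (e' \<union> f')"
        using A(8)[OF xy(1) ef] A(8)[OF xy(2) ef'] xy(4,5) by (metis IntI)+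
      then have "tip x i j \<in> \<pi> ` ((e \<union> f) \<inter> (e' \<union> f'))" "tip x i' j' \<in> \<pi> ` ((e \<union> f) \<inter> (e' \<union> f'))"
        using inj_on_image_Int[OF placement_inj sub] by auto
      then obtain u w where u: "u \<in> (e \<union> f) \<inter> (e' \<union> f')" "w \<in> (e \<union> f) \<inter> (e' \<union> f')"
        "tip x i j = \<pi> u" "tip x i' j' = \<pi> w" by blast
      have "u = w" using c u(1,2) card_le_Suc0_iff_eq[OF fin] by auto
      then show ?thesis using u by simp
    qed
    show "arm x i j \<in> S" "arm x i j \<inter> W = {x, tip x i j}" "tip x i j \<notin> P"
      "{f \<in> faces W S. incident W (arm x i j) f} = {mface x i, aface x j}" if "x \<in> P" for x i j
      by (rule A(1-3,6)[OF that])+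
    show "\<exists>i j. B = arm x i j" if "x \<in> P" "B \<in> S" "x \<in> B \<inter> W" for x B
      using A(4)[OF that(1,2)] that(3) by blast
    show "i = i' \<and> j = j'" if "x \<in> P" "arm x i j = arm x i' j'" for x i j i' j'
      by (rule A(5)[OF that])
    show "col (tip x i j) = col (tip x i' j') \<longleftrightarrow> i = i'" if "x \<in> P" for x i j i' j'
      by (rule A(7)[OF that])
  qed
  show ?thesis by (rule face_count)
qed

lemma card_edges:
  assumes n: "3 \<le> card V"
  shows "2 * card E + 10 \<le> 5 * card V"
proof -
  have "V \<noteq> {}" using n by auto
  then have "W \<noteq> {}" unfolding W_def by simp
  then have euler: "card S + 2 \<le> card (faces W S) + card W"
    by (rule plane_graph_euler(2)[OF plane])
  show ?thesis
  proof (cases "2 \<le> card (faces W S)")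
    case True
    \<comment> \<open>Here \<open>5 (m + k - n + 2) + k \<le> 3 (m + 2 k)\<close>, and
      \<open>k\<close> cancels.\<close>
    show ?thesis using euler face_count[OF True] card_S card_W by linarith
  next
    case False
    \<comment> \<open>With at most one face \<open>m + k + 1 \<le> n\<close>, hence
      \<open>2 m + 10 \<le> 2 n + 8\<close>, which is at most \<open>5 n\<close> since
      \<open>n \<ge> 3\<close>.\<close>
    then show ?thesis using euler card_S card_W n by linarith
  qed
qed

end

theorem theorem4:
  fixes V :: "'a set" and E :: "'a set set" and n :: nat
  assumes "simple_graph V E"
    and "card V = n"
    and "n \<ge> 3"
    and "bipartite_graph V E"
    and "nic_planar V E"
  shows "real (card E) \<le> 2.5 * real n - 5"
proof -
  obtain X Y where XY: "X \<union> Y = V" "X \<inter> Y = {}" "\<forall>e\<in>E. \<exists>a\<in>X. \<exists>b\<in>Y. e = {a, b}"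
    using assms(4) unfolding bipartite_graph_def by blast
  obtain \<pi> \<gamma> where "nic_drawing V E \<pi> \<gamma>"
    using assms(5) unfolding nic_planar_def by blast
  then interpret bipartite_nic_drawing V X Y E \<pi> \<gamma>
    using assms(1) XY by unfold_locales auto
  show ?thesis using card_edges assms(2,3) by simp
qed

end
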